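(* Let $n\ge2$ and $m\ge1$ be integers. Distribute $m$ balls independently and uniformly among $n$ urns, let $\xi_i$ be the number of balls in urn $i$, and let $$X_i=\frac{\xi_i-mn^{-1}}{\sqrt{m(1-n^{-1})}},\qquad i=1,\dots,n.$$ Let $\Sigma$ be the covariance matrix of $X=(X_1,\dots,X_n)$ and let $Z\sim\mathrm{MVN}_n(0,\Sigma)$. Then, for any three times partially differentiable function $h:\mathbb{R}^n\to\mathbb{R}$, $$|\mathbb{E}h(X)-\mathbb{E}h(Z)|\le\bigl(|h|_2+19\,|h|_3\bigr)\sqrt{\frac{n^2+4mn+6}{mn(n-1)}}.$$
   Context: $\mathrm{MVN}_n(0,\Sigma)$ is the centred Gaussian law on $\mathbb{R}^n$ with covariance matrix $\Sigma$. For $k\ge1$, $|h|_k=\sup_{1\le i_1\le\dots\le i_k\le n}\|h_{i_1\dots i_k}\|_\infty$, where $h_{i_1\dots i_k}$ denotes the partial derivative of $h$ in the indicated coordinates and $\|\cdot\|_\infty$ is the supremum norm (infinite bounds are vacuous). "Three times partially differentiable" means that all partial derivatives up to order three exist (mixed partial derivatives being independent of the order of differentiation). *)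

theory Defs
  imports "HOL-Probability.Probability"
begin

definition covariance_matrix :: "'a measure \<Rightarrow> ('a \<Rightarrow> real ^ 'n) \<Rightarrow> real ^ 'n ^ 'n" where
  "covariance_matrix M X =
     (\<chi> i j. \<integral>\<omega>. (X \<omega> $ i - (\<integral>\<omega>'. X \<omega>' $ i \<partial>M)) * (X \<omega> $ j - (\<integral>\<omega>'. X \<omega>' $ j \<partial>M)) \<partial>M)"

definition std_gaussian :: "(real ^ 'n) measure" where
  "std_gaussian = density lborel (\<lambda>x. ennreal (\<Prod>i\<in>UNIV. std_normal_density (x $ i)))"

text \<open>
  A centred Gaussian law is the image of the standard Gaussian law under a linear map. The map
  need not be invertible, so that singular covariance matrices (laws without a Lebesgue density)
  are included.
\<close>

definition centred_gaussian :: "(real ^ 'n) measure \<Rightarrow> bool" where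
  "centred_gaussian \<nu> \<longleftrightarrow> (\<exists>A :: real ^ 'n ^ 'n. \<nu> = distr std_gaussian borel (\<lambda>x. A *v x))"

definition is_MVN0 :: "real ^ 'n ^ 'n \<Rightarrow> (real ^ 'n) measure \<Rightarrow> bool" where
  "is_MVN0 \<Sigma> \<nu> \<longleftrightarrow> centred_gaussian \<nu> \<and> covariance_matrix \<nu> (\<lambda>x. x) = \<Sigma>"

definition has_partial_at :: "'n \<Rightarrow> (real ^ 'n \<Rightarrow> real) \<Rightarrow> real ^ 'n \<Rightarrow> bool" where
  "has_partial_at i f x \<longleftrightarrow> (\<lambda>t. f (x + t *\<^sub>R axis i 1)) field_differentiable at 0"

definition partial :: "'n \<Rightarrow> (real ^ 'n \<Rightarrow> real) \<Rightarrow> real ^ 'n \<Rightarrow> real" where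
  "partial i f x = deriv (\<lambda>t. f (x + t *\<^sub>R axis i 1)) 0"

primrec partials :: "'n list \<Rightarrow> (real ^ 'n \<Rightarrow> real) \<Rightarrow> real ^ 'n \<Rightarrow> real" where
  "partials [] f = f"
| "partials (i # is) f = partial i (partials is f)"

text \<open>
  Only existence of the partial derivatives and independence of the order of differentiation are
  required; no continuity and no total differentiability.
\<close>

definition three_times_partially_differentiable :: "(real ^ 'n \<Rightarrow> real) \<Rightarrow> bool" where
  "three_times_partially_differentiable f \<longleftrightarrow>
     (\<forall>is i x. length is < 3 \<longrightarrow> has_partial_at i (partials is f) x) \<and>
     (\<forall>is js. length is \<le> 3 \<and> mset is = mset js \<longrightarrow> partials is f = partials js f)"

text \<open>
  The supremum ranges over all index tuples of length \<open>k\<close> rather than only the nondecreasing ones,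
  since the coordinate type carries no order. Where mixed partial derivatives are independent of
  the order of differentiation, the two suprema coincide.
\<close>

definition deriv_sup_norm :: "nat \<Rightarrow> (real ^ 'n \<Rightarrow> real) \<Rightarrow> ereal" where
  "deriv_sup_norm k f = (SUP is \<in> {is. length is = k}. SUP x. ereal \<bar>partials is f x\<bar>)"

text \<open>\<open>B j\<close> is the urn (an element of the type \<open>'n\<close>) that receives ball \<open>j\<close>.\<close>

definition uniform_allocation :: "'a measure \<Rightarrow> nat \<Rightarrow> (nat \<Rightarrow> 'a \<Rightarrow> 'n::finite) \<Rightarrow> bool" where
  "uniform_allocation M m B \<longleftrightarrow> prob_space M \<and>
     prob_space.indep_vars M (\<lambda>_. count_space UNIV) B {..<m} \<and>
     (\<forall>j<m. distr M (count_space UNIV) (B j) = uniform_count_measure UNIV)"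

definition urn_count :: "nat \<Rightarrow> (nat \<Rightarrow> 'a \<Rightarrow> 'n) \<Rightarrow> 'n \<Rightarrow> 'a \<Rightarrow> nat" where
  "urn_count m B i \<omega> = card {j. j < m \<and> B j \<omega> = i}"

definition normalized_counts ::
    "nat \<Rightarrow> (nat \<Rightarrow> 'a \<Rightarrow> 'n::finite) \<Rightarrow> 'a \<Rightarrow> real ^ 'n" where
  "normalized_counts m B \<omega> =
     (\<chi> i. (real (urn_count m B i \<omega>) - real m / real CARD('n)) /
           sqrt (real m * (1 - 1 / real CARD('n))))"

end

theory Submission
  imports Defs
begin

text \<open>
  Write \<open>X\<close> as a sum of \<open>m\<close> independent copies of \<open>y / sqrt m\<close>, where \<open>y\<close> is the centred and scaled
  indicator vector of one ball. Each \<open>y\<close> has \<open>l1\<close> norm at most \<open>2\<close>, whatever \<open>n\<close> is, whereas the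
  \<open>l1\<close> norm of \<open>Z\<close> is of order \<open>sqrt n\<close>. So Lindeberg's exchange of \<open>y\<close> for a Gaussian vector would
  cost too much. Instead \<open>c y\<close> is exchanged for \<open>c (y' + y'') / sqrt 2\<close> with independent copies
  \<open>y', y''\<close> of \<open>y\<close>, which has the same covariance matrix and still a bounded \<open>l1\<close> norm, and this is
  repeated at the scales \<open>c / sqrt 2\<close>, \<open>c / 2\<close> and so on. The third-order errors form a geometric
  series, and the comparison with \<open>c Z\<close> is needed only in the limit, where its cost vanishes. The
  resulting bound is at most \<open>19 |h|\<^sub>3 / sqrt m\<close>, and \<open>1 / m\<close> is at most the quotient under the root.
\<close>

subsection \<open>Taylor expansion with bounded third partial derivatives\<close>

text \<open>The norm suited to coordinatewise bounds: if all third partial derivatives are bounded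
  by \<open>K\<close>, the third-order form at \<open>y\<close> is at most
  \<open>K * l1_norm y ^ 3\<close>, with no factor depending on the dimension.\<close>

definition l1_norm :: "real ^ 'n \<Rightarrow> real" where
  "l1_norm x = (\<Sum>i\<in>UNIV. \<bar>x $ i\<bar>)"

lemma l1_norm_nonneg [simp]: "0 \<le> l1_norm x"
  by (simp add: l1_norm_def sum_nonneg)

lemma l1_norm_scaleR: "l1_norm (c *\<^sub>R x) = \<bar>c\<bar> * l1_norm x"
  by (simp add: l1_norm_def abs_mult sum_distrib_left)

lemma l1_norm_triangle: "l1_norm (x + y) \<le> l1_norm x + l1_norm y"
  by (auto simp: l1_norm_def sum.distrib [symmetric] intro!: sum_mono)

lemma l1_norm_le_norm: "l1_norm (x :: real ^ 'n) \<le> real CARD('n) * norm x"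
proof -
  have "l1_norm x \<le> (\<Sum>i\<in>(UNIV :: 'n set). norm x)"
    unfolding l1_norm_def by (intro sum_mono component_le_norm_cart)
  then show ?thesis by simp
qed

text \<open>The derivative is given only at parameter \<open>0\<close>, but for every base point.
  Moving the base point along the axis yields it at every \<open>t\<close>, as the mean value
  theorem needs.\<close>

lemma has_partial_along:
  fixes g :: "real ^ 'n \<Rightarrow> real"
  assumes "\<And>z. ((\<lambda>t. g (z + t *\<^sub>R axis i 1)) has_real_derivative g' z) (at 0)"
  shows "((\<lambda>t. g (z + (t * c) *\<^sub>R axis i 1)) has_real_derivative c * g' (z + (t * c) *\<^sub>R axis i 1)) (at t)"
proof -
  let ?z = "z + (t * c) *\<^sub>R axis i 1"
  have "((\<lambda>u. (u - t) * c) has_real_derivative c) (at t)"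
    by (auto intro!: derivative_eq_intros)
  moreover have "((\<lambda>s. g (?z + s *\<^sub>R axis i 1)) has_real_derivative g' ?z) (at ((t - t) * c))"
    using assms by simp
  ultimately have "((\<lambda>u. g (?z + ((u - t) * c) *\<^sub>R axis i 1)) has_real_derivative g' ?z * c) (at t)"
    by (rule DERIV_chain2 [rotated])
  moreover have "(\<lambda>u. g (?z + ((u - t) * c) *\<^sub>R axis i 1)) = (\<lambda>u. g (z + (u * c) *\<^sub>R axis i 1))"
    by (simp add: algebra_simps)
  ultimately show ?thesis by (simp only: mult.commute [of "g' ?z"])
qed

text \<open>Walking from \<open>x\<close> to \<open>x + y\<close> one coordinate at a time takes
  only the mean value theorem on each leg, hence mere partial derivatives. The walk stays in the box
  described in \<open>bound\<close>, so the derivatives are controlled only there.\<close>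

lemma increment_bound:
  fixes g :: "real ^ 'n \<Rightarrow> real"
  assumes deriv: "\<And>i z. ((\<lambda>t. g (z + t *\<^sub>R axis i 1)) has_real_derivative g' i z) (at 0)"
    and bound: "\<And>i z. (\<And>j. \<bar>z $ j - x $ j\<bar> \<le> \<bar>y $ j\<bar>) \<Longrightarrow> \<bar>g' i z\<bar> \<le> w"
  shows "\<bar>g (x + y) - g x\<bar> \<le> w * l1_norm y"
proof -
  define p where "p S = (\<chi> i. if i \<in> S then y $ i else 0)" for S :: "'n set"
  have "\<bar>g (x + p S) - g x\<bar> \<le> w * (\<Sum>i\<in>S. \<bar>y $ i\<bar>)" if "finite S" for S
    using that
  proof induction
    case empty
    have "p {} = 0" by (simp add: p_def vec_eq_iff)
    then show ?case by simp
  next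
    case (insert k S)
    let ?f = "\<lambda>t. g ((x + p S) + (t * y $ k) *\<^sub>R axis k 1)"
    obtain t where t: "0 < t" "t < 1"
      and eq: "?f 1 - ?f 0 = (1 - 0) * (y $ k * g' k ((x + p S) + (t * y $ k) *\<^sub>R axis k 1))"
      using MVT2 [of 0 1 ?f, OF _ has_partial_along [OF deriv]] by auto
    have ins: "p (insert k S) = p S + y $ k *\<^sub>R axis k 1"
      using insert by (auto simp: p_def vec_eq_iff axis_def)
    have "\<bar>g' k ((x + p S) + (t * y $ k) *\<^sub>R axis k 1)\<bar> \<le> w"
    proof (rule bound)
      fix j
      show "\<bar>((x + p S) + (t * y $ k) *\<^sub>R axis k 1) $ j - x $ j\<bar> \<le> \<bar>y $ j\<bar>"
        using insert t by (cases "j = k") (auto simp: p_def axis_def abs_mult mult_left_le_one_le)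
    qed
    then have "\<bar>?f 1 - ?f 0\<bar> \<le> w * \<bar>y $ k\<bar>"
      unfolding eq by (simp add: abs_mult mult.commute [of w] mult_left_mono)
    moreover have "?f 1 = g (x + p (insert k S))" "?f 0 = g (x + p S)"
      by (simp_all add: ins add.assoc)
    ultimately show ?case
      using insert by (simp add: distrib_left)
  qed
  from this [of UNIV] show ?thesis
    by (simp add: p_def l1_norm_def)
qed

text \<open>\<open>increment_bound\<close> is applied to \<open>g\<close> minus its candidate linear
  part, whose partial derivatives \<open>g' i z - g' i x\<close> are small near \<open>x\<close> by
  continuity.\<close>

lemma has_derivative_if_continuous_partials:
  fixes g :: "real ^ 'n \<Rightarrow> real"
  assumes deriv: "\<And>i z. ((\<lambda>t. g (z + t *\<^sub>R axis i 1)) has_real_derivative g' i z) (at 0)"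
    and cont: "\<And>i. isCont (g' i) x"
  shows "(g has_derivative (\<lambda>y. \<Sum>i\<in>UNIV. g' i x * y $ i)) (at x)"
  unfolding has_derivative_at_alt
proof (intro conjI allI impI)
  show "bounded_linear (\<lambda>y :: real ^ 'n. \<Sum>i\<in>UNIV. g' i x * y $ i)"
    by (intro bounded_linear_sum bounded_linear_const_mult bounded_linear_vec_nth)
  fix e :: real assume "0 < e"
  \<comment> \<open>Both \<open>w\<close> and \<open>d'\<close> below divide by
    \<open>CARD('n)\<close> to compensate \<open>l1_norm_le_norm\<close>: once in the final
    estimate, once to keep the box within distance \<open>d\<close> of \<open>x\<close>.\<close>
  define w where "w = e / real CARD('n)"
  have "w > 0" using \<open>0 < e\<close> by (simp add: w_def)
  have "\<forall>\<^sub>F z in at x. \<forall>i. \<bar>g' i z - g' i x\<bar> < w"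
    using cont \<open>w > 0\<close> by (auto simp: eventually_all_finite isCont_def tendsto_iff dist_real_def)
  then obtain d where "d > 0" and d: "\<And>z i. z \<noteq> x \<Longrightarrow> dist z x < d \<Longrightarrow> \<bar>g' i z - g' i x\<bar> < w"
    unfolding eventually_at by auto
  define d' where "d' = d / real CARD('n)"
  have "d' > 0" using \<open>d > 0\<close> by (simp add: d'_def)
  have "norm (g z - g x - (\<Sum>i\<in>UNIV. g' i x * (z - x) $ i)) \<le> e * norm (z - x)" if "norm (z - x) < d'" for z
  proof -
    let ?k = "\<lambda>z. g z - (\<Sum>i\<in>UNIV. g' i x * z $ i)"
    have kd: "((\<lambda>t. ?k (z + t *\<^sub>R axis i 1)) has_real_derivative g' i z - g' i x) (at 0)" for i z
    proof -
      have "((\<lambda>t. \<Sum>j\<in>UNIV. g' j x * (z + t *\<^sub>R axis i 1) $ j) has_real_derivative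
          (\<Sum>j\<in>UNIV. g' j x * (axis i 1 :: real ^ 'n) $ j)) (at 0)"
        by (auto intro!: derivative_eq_intros simp: mult.commute)
      moreover have "(\<Sum>j\<in>UNIV. g' j x * (axis i 1 :: real ^ 'n) $ j) = g' i x"
        by (simp add: axis_def if_distrib [of "\<lambda>u. _ * u"] cong: if_cong)
      ultimately show ?thesis using deriv [of z i] by (auto intro!: DERIV_diff)
    qed
    have "\<bar>?k (x + (z - x)) - ?k x\<bar> \<le> w * l1_norm (z - x)"
    proof (rule increment_bound [OF kd])
      fix i u assume u: "\<And>j. \<bar>u $ j - x $ j\<bar> \<le> \<bar>(z - x) $ j\<bar>"
      have "norm (u - x) \<le> l1_norm (u - x)"
        unfolding l1_norm_def by (rule norm_le_l1_cart)
      also have "\<dots> \<le> l1_norm (z - x)"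
        unfolding l1_norm_def using u by (intro sum_mono) simp
      also have "\<dots> \<le> real CARD('n) * norm (z - x)" by (rule l1_norm_le_norm)
      also have "\<dots> < d" using that by (simp add: d'_def field_simps)
      finally have "dist u x < d" by (simp add: dist_norm)
      then show "\<bar>g' i u - g' i x\<bar> \<le> w"
        using d [of u i] \<open>w > 0\<close> by (cases "u = x") auto
    qed
    also have "\<dots> \<le> w * (real CARD('n) * norm (z - x))"
      using \<open>w > 0\<close> l1_norm_le_norm by (intro mult_left_mono) auto
    also have "\<dots> = e * norm (z - x)" by (simp add: w_def)
    finally show ?thesis
      by (simp add: algebra_simps sum.distrib sum_subtractf)
  qed
  then show "\<exists>d>0. \<forall>z. norm (z - x) < d \<longrightarrow>
      norm (g z - g x - (\<Sum>i\<in>UNIV. g' i x * (z - x) $ i)) \<le> e * norm (z - x)"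
    using \<open>d' > 0\<close> by blast
qed

lemma has_real_derivative_along_line:
  fixes g :: "real ^ 'n \<Rightarrow> real"
  assumes "\<And>z. (g has_derivative (\<lambda>y. \<Sum>i\<in>UNIV. g' i z * y $ i)) (at z)"
  shows "((\<lambda>t. g (x + t *\<^sub>R y)) has_real_derivative (\<Sum>i\<in>UNIV. g' i (x + t *\<^sub>R y) * y $ i)) (at t)"
proof -
  have "((\<lambda>t. x + t *\<^sub>R y) has_derivative (\<lambda>s. s *\<^sub>R y)) (at t)"
    by (auto intro!: derivative_eq_intros)
  from has_derivative_compose [OF this assms]
  have "((\<lambda>t. g (x + t *\<^sub>R y)) has_derivative
      (\<lambda>s. \<Sum>i\<in>UNIV. g' i (x + t *\<^sub>R y) * (s *\<^sub>R y) $ i)) (at t)" .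
  moreover have "(\<lambda>s. \<Sum>i\<in>UNIV. g' i (x + t *\<^sub>R y) * (s *\<^sub>R y) $ i) =
      (*) (\<Sum>i\<in>UNIV. g' i (x + t *\<^sub>R y) * y $ i)"
    by (simp add: fun_eq_iff sum_distrib_left mult_ac)
  ultimately show ?thesis
    by (simp only: has_field_derivative_def)
qed

lemma nonpos_if_deriv_nonpos:
  fixes f :: "real \<Rightarrow> real"
  assumes "\<And>t. (f has_real_derivative f' t) (at t)" "\<And>t. 0 \<le> t \<Longrightarrow> f' t \<le> 0" "f 0 = 0" "0 \<le> t"
  shows "f t \<le> 0"
proof -
  have "f t \<le> f 0"
    by (rule DERIV_nonpos_imp_nonincreasing [OF assms(4)]) (use assms in blast)
  then show ?thesis using assms by simp
qed

text \<open>Third partial derivatives need not be continuous, so along a segment the second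
  derivative is only known to satisfy \<open>lip\<close>. This inequality takes the place of a third
  derivative and is integrated twice by monotonicity.\<close>

lemma second_order_remainder:
  fixes f :: "real \<Rightarrow> real"
  assumes f: "\<And>t. (f has_real_derivative f1 t) (at t)" "\<And>t. (f1 has_real_derivative f2 t) (at t)"
    and lip: "\<And>t. 0 \<le> t \<Longrightarrow> \<bar>f2 t - f2 0\<bar> \<le> L * t"
  shows "\<bar>f 1 - f 0 - f1 0 - f2 0 / 2\<bar> \<le> L / 6"
proof -
  \<comment> \<open>The sign \<open>s\<close> treats the upper and the lower bound at once.\<close>
  have upper: "s * (f 1 - f 0 - f1 0 - f2 0 / 2) \<le> L / 6" if "\<bar>s\<bar> = 1" for s :: real
  proof -
    let ?r = "\<lambda>t. s * (f t - f 0 - f1 0 * t - f2 0 * t^2 / 2) - L * t^3 / 6"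
    let ?r1 = "\<lambda>t. s * (f1 t - f1 0 - f2 0 * t) - L * t^2 / 2"
    let ?r2 = "\<lambda>t. s * (f2 t - f2 0) - L * t"
    have r: "(?r has_real_derivative ?r1 t) (at t)" and r1: "(?r1 has_real_derivative ?r2 t) (at t)" for t
      by (auto intro!: derivative_eq_intros f simp: algebra_simps power2_eq_square power3_eq_cube)
    have r2: "?r2 t \<le> 0" if "0 \<le> t" for t
    proof -
      have "s * (f2 t - f2 0) \<le> \<bar>s * (f2 t - f2 0)\<bar>" by simp
      also have "\<dots> \<le> L * t" using lip [OF that] \<open>\<bar>s\<bar> = 1\<close> by (simp add: abs_mult)
      finally show ?thesis by simp
    qed
    have "?r1 t \<le> 0" if "0 \<le> t" for t
      by (rule nonpos_if_deriv_nonpos [OF r1 r2 _ that]) auto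
    from nonpos_if_deriv_nonpos [OF r this, of 1] show ?thesis by simp
  qed
  show ?thesis
  proof (rule abs_leI)
    show "f 1 - f 0 - f1 0 - f2 0 / 2 \<le> L / 6" "- (f 1 - f 0 - f1 0 - f2 0 / 2) \<le> L / 6"
      using upper [of 1] upper [of "-1"] by (simp_all only: abs_one abs_minus mult_1 mult_minus_left simp_thms)
  qed
qed

text \<open>Bounded third partial derivatives make each \<open>h2 i j\<close> Lipschitz, hence
  continuous. So first each \<open>h1 i\<close> and then \<open>h\<close> is totally differentiable,
  and the chain rule applies twice along \<open>x + t *\<^sub>R y\<close>.\<close>

lemma taylor_second_order:
  fixes h :: "real ^ 'n \<Rightarrow> real"
  assumes h: "\<And>i z. ((\<lambda>t. h (z + t *\<^sub>R axis i 1)) has_real_derivative h1 i z) (at 0)"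
    and h1: "\<And>i j z. ((\<lambda>t. h1 i (z + t *\<^sub>R axis j 1)) has_real_derivative h2 i j z) (at 0)"
    and h2: "\<And>i j k z. ((\<lambda>t. h2 i j (z + t *\<^sub>R axis k 1)) has_real_derivative h3 i j k z) (at 0)"
    and h3: "\<And>i j k z. \<bar>h3 i j k z\<bar> \<le> K"
  shows "\<bar>h (x + y) - h x - (\<Sum>i\<in>UNIV. h1 i x * y $ i)
           - (\<Sum>i\<in>UNIV. \<Sum>j\<in>UNIV. h2 i j x * (y $ i * y $ j)) / 2\<bar> \<le> K / 6 * l1_norm y ^ 3"
    and "continuous_on UNIV h"
proof -
  have lip: "\<bar>h2 i j (x + y) - h2 i j x\<bar> \<le> K * l1_norm y" for i j x y
    by (rule increment_bound [OF h2 h3])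
  have "K \<ge> 0" using h3 abs_ge_zero order_trans by blast
  have "isCont (h2 i j) x" for i j x
    unfolding continuous_at_eps_delta
  proof (intro allI impI)
    fix e :: real assume "e > 0"
    \<comment> \<open>The \<open>+ 1\<close> keeps the denominator positive when
      \<open>K = 0\<close>.\<close>
    define d where "d = e / (K * real CARD('n) + 1)"
    have pos: "K * real CARD('n) + 1 > 0" using \<open>K \<ge> 0\<close> by (simp add: add_nonneg_pos)
    show "\<exists>d>0. \<forall>z. dist z x < d \<longrightarrow> dist (h2 i j z) (h2 i j x) < e"
    proof (intro exI conjI allI impI)
      show "d > 0" using \<open>e > 0\<close> pos by (simp add: d_def)
      fix z assume z: "dist z x < d"
      have "\<bar>h2 i j (x + (z - x)) - h2 i j x\<bar> \<le> K * l1_norm (z - x)" by (rule lip)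
      also have "\<dots> \<le> K * (real CARD('n) * norm (z - x))"
        using \<open>K \<ge> 0\<close> l1_norm_le_norm by (intro mult_left_mono) auto
      also have "\<dots> \<le> (K * real CARD('n) + 1) * norm (z - x)"
        by (simp add: algebra_simps)
      also have "\<dots> < (K * real CARD('n) + 1) * d"
        using z pos by (intro mult_strict_left_mono) (auto simp: dist_norm)
      also have "\<dots> = e" using pos by (simp add: d_def)
      finally show "dist (h2 i j z) (h2 i j x) < e" by (simp add: dist_real_def)
    qed
  qed
  then have D1: "(h1 i has_derivative (\<lambda>y. \<Sum>j\<in>UNIV. h2 i j z * y $ j)) (at z)" for i z
    using has_derivative_if_continuous_partials [OF h1, of z i] by simp
  have D0: "(h has_derivative (\<lambda>y. \<Sum>i\<in>UNIV. h1 i z * y $ i)) (at z)" for z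
    by (rule has_derivative_if_continuous_partials [OF h has_derivative_continuous [OF D1]])
  show "continuous_on UNIV h"
    using has_derivative_continuous [OF D0] by (simp add: continuous_on_eq_continuous_at)
  let ?f2 = "\<lambda>t. \<Sum>i\<in>UNIV. (\<Sum>j\<in>UNIV. h2 i j (x + t *\<^sub>R y) * y $ j) * y $ i"
  have "\<bar>h (x + 1 *\<^sub>R y) - h (x + 0 *\<^sub>R y) - (\<Sum>i\<in>UNIV. h1 i (x + 0 *\<^sub>R y) * y $ i) - ?f2 0 / 2\<bar>
      \<le> (K * l1_norm y ^ 3) / 6"
  proof (rule second_order_remainder)
    show "((\<lambda>t. h (x + t *\<^sub>R y)) has_real_derivative (\<Sum>i\<in>UNIV. h1 i (x + t *\<^sub>R y) * y $ i)) (at t)" for t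
      by (rule has_real_derivative_along_line [OF D0])
    show "((\<lambda>t. \<Sum>i\<in>UNIV. h1 i (x + t *\<^sub>R y) * y $ i) has_real_derivative ?f2 t) (at t)" for t
      by (intro DERIV_sum DERIV_cmult_right has_real_derivative_along_line [OF D1])
    fix t :: real assume "0 \<le> t"
    \<comment> \<open>One factor \<open>l1_norm y\<close> comes from \<open>lip\<close>, the other
      two from the sums over \<open>i\<close> and \<open>j\<close>.\<close>
    have "\<bar>?f2 t - ?f2 0\<bar> = \<bar>\<Sum>i\<in>UNIV. (\<Sum>j\<in>UNIV. (h2 i j (x + t *\<^sub>R y) - h2 i j x) * y $ j) * y $ i\<bar>"
      by (simp add: sum_subtractf left_diff_distrib)
    also have "\<dots> \<le> (\<Sum>i\<in>UNIV. (\<Sum>j\<in>UNIV. (K * l1_norm (t *\<^sub>R y)) * \<bar>y $ j\<bar>) * \<bar>y $ i\<bar>)"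
      using lip
      by (intro order_trans [OF sum_abs] sum_mono) 
         (auto simp: abs_mult intro!: mult_right_mono order_trans [OF sum_abs] sum_mono)
    also have "\<dots> = K * l1_norm y ^ 3 * t"
      using \<open>0 \<le> t\<close>
      by (simp add: sum_distrib_left [symmetric] sum_distrib_right [symmetric] l1_norm_scaleR power3_eq_cube)
         (simp add: l1_norm_def)
    finally show "\<bar>?f2 t - ?f2 0\<bar> \<le> K * l1_norm y ^ 3 * t" .
  qed
  then show "\<bar>h (x + y) - h x - (\<Sum>i\<in>UNIV. h1 i x * y $ i)
           - (\<Sum>i\<in>UNIV. \<Sum>j\<in>UNIV. h2 i j x * (y $ i * y $ j)) / 2\<bar> \<le> K / 6 * l1_norm y ^ 3"
    by (simp add: sum_distrib_right sum_distrib_left mult_ac)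
qed

subsection \<open>Centred laws with third moments\<close>

definition third_moment :: "(real ^ 'n) measure \<Rightarrow> bool" where
  "third_moment \<mu> \<longleftrightarrow> prob_space \<mu> \<and> sets \<mu> = sets borel \<and> integrable \<mu> (\<lambda>x. norm x ^ 3)"

definition centred_law :: "real ^ 'n ^ 'n \<Rightarrow> (real ^ 'n) measure \<Rightarrow> bool" where
  "centred_law S \<mu> \<longleftrightarrow> third_moment \<mu> \<and> (\<forall>i. (\<integral>x. x $ i \<partial>\<mu>) = 0) \<and>
     (\<forall>i j. (\<integral>x. x $ i * x $ j \<partial>\<mu>) = S $ i $ j)"

text \<open>A class of integrands that are integrable under every law with a third moment. It is
  closed under sums and shifts, so integrability follows from closure rules.\<close>

definition cubic_growth :: "(real ^ 'n \<Rightarrow> real) \<Rightarrow> bool" where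
  "cubic_growth f \<longleftrightarrow> f \<in> borel_measurable borel \<and> (\<exists>C\<ge>0. \<forall>x. \<bar>f x\<bar> \<le> C * (1 + norm x ^ 3))"

lemma third_momentD:
  assumes "third_moment \<mu>"
  shows "prob_space \<mu>" "sets \<mu> = sets borel" "space \<mu> = UNIV" "integrable \<mu> (\<lambda>x. norm x ^ 3)"
    "measurable \<mu> N = measurable borel N"
  using assms sets_eq_imp_space_eq [of \<mu> borel] measurable_cong_sets [of \<mu> borel N N]
  by (auto simp: third_moment_def)

lemma cubic_growthI:
  assumes "f \<in> borel_measurable borel" "\<And>x. \<bar>f x\<bar> \<le> C * (1 + norm x ^ 3)"
  shows "cubic_growth f"
proof -
  have "0 \<le> \<bar>f 0\<bar>" by simp
  also have "\<dots> \<le> C" using assms(2) [of 0] by simp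
  finally show ?thesis using assms by (auto simp: cubic_growth_def)
qed

lemma cubic_growth_measurable : "cubic_growth f \<Longrightarrow> f \<in> borel_measurable borel"
  by (simp add: cubic_growth_def)

lemma cubic_growth_integrable:
  assumes \<mu>: "third_moment \<mu>" and f: "cubic_growth f"
  shows "integrable \<mu> f"
proof -
  interpret prob_space \<mu> using \<mu> by (rule third_momentD)
  obtain C where C: "\<And>x. \<bar>f x\<bar> \<le> C * (1 + norm x ^ 3)" using f by (auto simp: cubic_growth_def)
  have "integrable \<mu> (\<lambda>x. C * (1 + norm x ^ 3))"
    using third_momentD(4) [OF \<mu>] by simp
  moreover have "f \<in> borel_measurable \<mu>"
    using f by (simp add: cubic_growth_def third_momentD(5) [OF \<mu>])
  ultimately show ?thesis
    by (rule Bochner_Integration.integrable_bound) (use C in \<open>auto intro: order_trans [OF C abs_ge_self]\<close>)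
qed

lemma cubic_growth_mult: "cubic_growth f \<Longrightarrow> cubic_growth (\<lambda>x. c * f x)"
proof -
  assume f: "cubic_growth f"
  then obtain C where C: "\<And>x. \<bar>f x\<bar> \<le> C * (1 + norm x ^ 3)" by (auto simp: cubic_growth_def)
  show ?thesis
    by (rule cubic_growthI [where C = "\<bar>c\<bar> * C"])
      (use f C in \<open>auto simp: abs_mult mult.assoc cubic_growth_def intro: mult_left_mono\<close>)
qed

lemma cubic_growth_add: "cubic_growth f \<Longrightarrow> cubic_growth g \<Longrightarrow> cubic_growth (\<lambda>x. f x + g x)"
proof -
  assume f: "cubic_growth f" and g: "cubic_growth g"
  obtain C where C: "\<And>x. \<bar>f x\<bar> \<le> C * (1 + norm x ^ 3)" using f by (auto simp: cubic_growth_def)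
  obtain D where D: "\<And>x. \<bar>g x\<bar> \<le> D * (1 + norm x ^ 3)" using g by (auto simp: cubic_growth_def)
  show ?thesis
  proof (rule cubic_growthI [where C = "C + D"])
    show "(\<lambda>x. f x + g x) \<in> borel_measurable borel" using f g by (auto simp: cubic_growth_def)
    show "\<bar>f x + g x\<bar> \<le> (C + D) * (1 + norm x ^ 3)" for x
      using C [of x] D [of x] unfolding distrib_right by linarith
  qed
qed

lemma cubic_growth_const: "cubic_growth (\<lambda>x. c)"
  by (rule cubic_growthI [where C = "\<bar>c\<bar>"]) (auto simp: mult_le_cancel_left1)

lemma cubic_growth_sum:
  "(\<And>i. i \<in> I \<Longrightarrow> cubic_growth (f i)) \<Longrightarrow> cubic_growth (\<lambda>x. \<Sum>i\<in>I. f i x)"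
  by (induction I rule: infinite_finite_induct) (auto intro: cubic_growth_add cubic_growth_const)

lemma cube_sum_le: "0 \<le> a \<Longrightarrow> 0 \<le> b \<Longrightarrow> (a + b) ^ 3 \<le> 4 * (a ^ 3 + b ^ 3)" for a b :: real
proof -
  assume "0 \<le> a" "0 \<le> b"
  then have "0 \<le> 3 * (a + b) * (a - b)\<^sup>2" by simp
  also have "\<dots> = 4 * (a ^ 3 + b ^ 3) - (a + b) ^ 3"
    by (simp add: power2_eq_square power3_eq_cube algebra_simps)
  finally show ?thesis by simp
qed

lemma norm_add_cube_le: "norm (x + y) ^ 3 \<le> 4 * (norm x ^ 3 + norm y ^ 3)"
  by (rule order_trans [OF power_mono [OF norm_triangle_ineq] cube_sum_le]) auto

text \<open>Shifts occur because \<open>close\<close> tests laws against all translates of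
  \<open>h\<close>, and because Fubini leaves translated integrands inside.\<close>

lemma cubic_growth_shift:
  assumes f: "cubic_growth f"
  shows "cubic_growth (\<lambda>x. f (s + x))"
proof -
  obtain C where C: "\<And>x. \<bar>f x\<bar> \<le> C * (1 + norm x ^ 3)" "C \<ge> 0"
    using f by (auto simp: cubic_growth_def)
  show ?thesis
  proof (rule cubic_growthI)
    show "(\<lambda>x. f (s + x)) \<in> borel_measurable borel" using f by (auto simp: cubic_growth_def)
    fix x
    have "\<bar>f (s + x)\<bar> \<le> C * (1 + norm (s + x) ^ 3)" by (rule C)
    also have "\<dots> \<le> C * ((4 + 4 * norm s ^ 3) * (1 + norm x ^ 3))"
    proof (rule mult_left_mono [OF _ C(2)])
      show "1 + norm (s + x) ^ 3 \<le> (4 + 4 * norm s ^ 3) * (1 + norm x ^ 3)"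
        using norm_add_cube_le [of s x] mult_nonneg_nonneg [OF zero_le_power zero_le_power, OF norm_ge_zero norm_ge_zero, of s 3 x 3]
        unfolding ring_distribs by linarith
    qed
    finally show "\<bar>f (s + x)\<bar> \<le> (C * (4 + 4 * norm s ^ 3)) * (1 + norm x ^ 3)" by (simp add: mult.assoc)
  qed
qed

lemma le_one_plus_cube: "0 \<le> t \<Longrightarrow> t \<le> 1 + t ^ 3" "0 \<le> t \<Longrightarrow> t ^ 2 \<le> 1 + t ^ 3" for t :: real
proof -
  assume "0 \<le> t"
  have "t \<le> 1 + t ^ 3 \<and> t ^ 2 \<le> 1 + t ^ 3"
  proof (cases "t \<le> 1")
    case True
    then show ?thesis
      using \<open>0 \<le> t\<close> power_le_one [of t 2] zero_le_power [of t 3] by linarith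
  next
    case False
    then show ?thesis
      using power_increasing [of 1 3 t, simplified] power_increasing [of 2 3 t] by linarith
  qed
  then show "t \<le> 1 + t ^ 3" "t ^ 2 \<le> 1 + t ^ 3" by auto
qed

lemma cubic_growth_component: "cubic_growth (\<lambda>x. x $ i)"
  by (rule cubic_growthI [where C = 1])
    (auto intro: order_trans [OF component_le_norm_cart le_one_plus_cube(1)])

lemma cubic_growth_component2: "cubic_growth (\<lambda>x. x $ i * x $ j)"
proof (rule cubic_growthI [where C = 1])
  fix x :: "real ^ 'a"
  have "\<bar>x $ i * x $ j\<bar> \<le> norm x ^ 2"
    by (simp add: abs_mult power2_eq_square mult_mono component_le_norm_cart)
  then show "\<bar>x $ i * x $ j\<bar> \<le> 1 * (1 + norm x ^ 3)"
    using le_one_plus_cube(2) [of "norm x"] by simp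
qed auto

lemma cubic_growth_l1: "cubic_growth (\<lambda>x :: real ^ 'n. l1_norm x ^ 3)"
proof (rule cubic_growthI)
  show "(\<lambda>x :: real ^ 'n. l1_norm x ^ 3) \<in> borel_measurable borel" by (simp add: l1_norm_def)
  fix x :: "real ^ 'n"
  have "l1_norm x ^ 3 \<le> (real CARD('n) * norm x) ^ 3"
    by (rule power_mono [OF l1_norm_le_norm l1_norm_nonneg])
  also have "\<dots> \<le> real CARD('n) ^ 3 * (1 + norm x ^ 3)" by (simp add: power_mult_distrib)
  finally show "\<bar>l1_norm x ^ 3\<bar> \<le> real CARD('n) ^ 3 * (1 + norm x ^ 3)" by simp
qed

section \<open>Convolutions of laws: Fubini and moments\<close>

lemma
  assumes \<mu>: "third_moment \<mu>" and \<nu>: "third_moment \<nu>"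
  shows third_moment_convolution: "third_moment (\<mu> \<star> \<nu>)"
    and integral_convolution: "\<And>f. cubic_growth f \<Longrightarrow> (\<integral>x. f x \<partial>(\<mu> \<star> \<nu>)) = (\<integral>x. \<integral>y. f (x + y) \<partial>\<nu> \<partial>\<mu>)"
    and integral_convolution': "\<And>f. cubic_growth f \<Longrightarrow> (\<integral>x. f x \<partial>(\<mu> \<star> \<nu>)) = (\<integral>y. \<integral>x. f (x + y) \<partial>\<mu> \<partial>\<nu>)"
    and integrable_convolution_inner: "\<And>f. cubic_growth f \<Longrightarrow> integrable \<mu> (\<lambda>x. \<integral>y. f (x + y) \<partial>\<nu>)"
    and integrable_convolution_inner': "\<And>f. cubic_growth f \<Longrightarrow> integrable \<nu> (\<lambda>y. \<integral>x. f (x + y) \<partial>\<mu>)"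
proof -
  interpret \<mu>: prob_space \<mu> using \<mu> by (rule third_momentD)
  interpret \<nu>: prob_space \<nu> using \<nu> by (rule third_momentD)
  interpret pair_prob_space \<mu> \<nu> ..
  note [measurable_cong] = third_momentD(2) [OF \<mu>] third_momentD(2) [OF \<nu>]
  have fst: "integrable (\<mu> \<Otimes>\<^sub>M \<nu>) (\<lambda>p. norm (fst p) ^ 3)"
    using integrable_distr_eq [of fst "\<mu> \<Otimes>\<^sub>M \<nu>" \<mu> "\<lambda>x. norm x ^ 3"] third_momentD(4) [OF \<mu>]
    by (simp add: \<nu>.distr_pair_fst)
  have snd: "integrable (\<mu> \<Otimes>\<^sub>M \<nu>) (\<lambda>p. norm (snd p) ^ 3)"
  proof -
    interpret Q: pair_prob_space \<nu> \<mu> ..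
    have "integrable (\<nu> \<Otimes>\<^sub>M \<mu>) (\<lambda>p. norm (fst p) ^ 3)"
      using integrable_distr_eq [of fst "\<nu> \<Otimes>\<^sub>M \<mu>" \<nu> "\<lambda>x. norm x ^ 3"] third_momentD(4) [OF \<nu>]
      by (simp add: \<mu>.distr_pair_fst)
    from Q.integrable_product_swap [OF this] show ?thesis by (simp add: case_prod_beta')
  qed
  \<comment> \<open>The dominating function \<open>C * (1 + 4 * (norm x ^ 3 + norm y ^ 3))\<close>
    is a sum of functions of one variable each, hence integrable on the product. This licenses both
    orders of integration.\<close>
  have pair: "integrable (\<mu> \<Otimes>\<^sub>M \<nu>) (\<lambda>p. f (fst p + snd p))" if f: "cubic_growth f" for f
  proof -
    obtain C where C: "\<And>x. \<bar>f x\<bar> \<le> C * (1 + norm x ^ 3)" "C \<ge> 0"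
      using f by (auto simp: cubic_growth_def)
    have [measurable]: "f \<in> borel_measurable borel" using f by (simp add: cubic_growth_def)
    show ?thesis
    proof (rule Bochner_Integration.integrable_bound)
      show "integrable (\<mu> \<Otimes>\<^sub>M \<nu>) (\<lambda>p. C * (1 + 4 * (norm (fst p) ^ 3 + norm (snd p) ^ 3)))"
        using fst snd by (intro integrable_mult_right Bochner_Integration.integrable_add) auto
      have "\<bar>f (x + y)\<bar> \<le> C * (1 + 4 * (norm x ^ 3 + norm y ^ 3))" for x y
        by (rule order_trans [OF C(1) mult_left_mono [OF _ C(2)]]) (use norm_add_cube_le [of x y] in simp)
      then show "AE p in \<mu> \<Otimes>\<^sub>M \<nu>. norm (f (fst p + snd p)) \<le>
          norm (C * (1 + 4 * (norm (fst p) ^ 3 + norm (snd p) ^ 3)))"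
        by (auto intro: order_trans [OF _ abs_ge_self])
    qed measurable
  qed
  have meas: "(\<lambda>(x, y). x + y) \<in> measurable (\<mu> \<Otimes>\<^sub>M \<nu>) borel" by measurable
  have cubic3: "cubic_growth (\<lambda>x. norm x ^ 3 :: real)"
    by (rule cubic_growthI [where C = 1]) auto
  show "third_moment (\<mu> \<star> \<nu>)"
    unfolding third_moment_def
    using pair [OF cubic3] meas
    by (auto simp: convolution_def integrable_distr_eq case_prod_beta' intro!: prob_space_distr)
  fix f :: "real ^ 'a \<Rightarrow> real" assume f: "cubic_growth f"
  have [measurable]: "f \<in> borel_measurable borel" using f by (simp add: cubic_growth_def)
  have eq: "(\<integral>x. f x \<partial>(\<mu> \<star> \<nu>)) = (\<integral>p. f (fst p + snd p) \<partial>(\<mu> \<Otimes>\<^sub>M \<nu>))"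
    unfolding convolution_def by (subst integral_distr) (auto simp: case_prod_beta')
  have case_prod: "integrable (\<mu> \<Otimes>\<^sub>M \<nu>) (case_prod (\<lambda>x y. f (x + y)))"
    using pair [OF f] by (simp add: case_prod_beta')
  show "(\<integral>x. f x \<partial>(\<mu> \<star> \<nu>)) = (\<integral>x. \<integral>y. f (x + y) \<partial>\<nu> \<partial>\<mu>)"
    unfolding eq integral_fst [OF case_prod] by (simp add: case_prod_beta')
  show "(\<integral>x. f x \<partial>(\<mu> \<star> \<nu>)) = (\<integral>y. \<integral>x. f (x + y) \<partial>\<mu> \<partial>\<nu>)"
    unfolding eq integral_snd [OF case_prod] by (simp add: case_prod_beta')
  show "integrable \<mu> (\<lambda>x. \<integral>y. f (x + y) \<partial>\<nu>)" by (rule integrable_fst [OF case_prod])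
  show "integrable \<nu> (\<lambda>y. \<integral>x. f (x + y) \<partial>\<mu>)" by (rule integrable_snd [OF case_prod])
qed

text \<open>The cross terms \<open>x $ i * y $ j\<close> integrate to zero because both means
  vanish, so the covariances add.\<close>

lemma centred_law_convolution:
  assumes \<mu>: "centred_law S \<mu>" and \<nu>: "centred_law T \<nu>"
  shows "centred_law (S + T) (\<mu> \<star> \<nu>)"
proof -
  have t\<mu>: "third_moment \<mu>" and t\<nu>: "third_moment \<nu>" using assms by (auto simp: centred_law_def)
  interpret \<mu>: prob_space \<mu> using t\<mu> by (rule third_momentD)
  interpret \<nu>: prob_space \<nu> using t\<nu> by (rule third_momentD)
  note int = cubic_growth_integrable [OF t\<mu> cubic_growth_component]
    cubic_growth_integrable [OF t\<nu> cubic_growth_component]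
    cubic_growth_integrable [OF t\<mu> cubic_growth_component2]
    cubic_growth_integrable [OF t\<nu> cubic_growth_component2]
  note m = \<mu> [unfolded centred_law_def] \<nu> [unfolded centred_law_def]
  have "(\<integral>x. x $ i \<partial>(\<mu> \<star> \<nu>)) = 0" for i
    by (subst integral_convolution [OF t\<mu> t\<nu> cubic_growth_component])
      (use int m in \<open>simp add: \<mu>.prob_space \<nu>.prob_space\<close>)
  moreover have "(\<integral>x. x $ i * x $ j \<partial>(\<mu> \<star> \<nu>)) = (S + T) $ i $ j" for i j
    by (subst integral_convolution [OF t\<mu> t\<nu> cubic_growth_component2])
      (use int m in \<open>simp add: \<mu>.prob_space \<nu>.prob_space algebra_simps\<close>)
  ultimately show ?thesis
    using third_moment_convolution [OF t\<mu> t\<nu>] by (auto simp: centred_law_def)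
qed

definition l1_cube :: "(real ^ 'n) measure \<Rightarrow> real" where
  "l1_cube \<mu> = (\<integral>x. l1_norm x ^ 3 \<partial>\<mu>)"

text \<open>Triangle inequality and \<open>cube_sum_le\<close>. The factor \<open>4\<close>
  reappears in \<open>lindeberg_constant\<close>, where \<open>2 * sqrt 2\<close> is
  \<open>4 * 2 * (1 / sqrt 2) ^ 3\<close>.\<close>

lemma l1_cube_convolution:
  assumes \<mu>: "third_moment \<mu>" and \<nu>: "third_moment \<nu>"
  shows "l1_cube (\<mu> \<star> \<nu>) \<le> 4 * (l1_cube \<mu> + l1_cube \<nu>)"
proof -
  interpret \<mu>: prob_space \<mu> using \<mu> by (rule third_momentD)
  interpret \<nu>: prob_space \<nu> using \<nu> by (rule third_momentD)
  note int = cubic_growth_integrable [OF \<mu> cubic_growth_l1] cubic_growth_integrable [OF \<nu> cubic_growth_l1]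
  have "l1_cube (\<mu> \<star> \<nu>) = (\<integral>x. \<integral>y. l1_norm (x + y) ^ 3 \<partial>\<nu> \<partial>\<mu>)"
    unfolding l1_cube_def by (rule integral_convolution [OF \<mu> \<nu> cubic_growth_l1])
  also have "\<dots> \<le> (\<integral>x. \<integral>y. 4 * (l1_norm x ^ 3 + l1_norm y ^ 3) \<partial>\<nu> \<partial>\<mu>)"
  proof (intro integral_mono integrable_convolution_inner [OF \<mu> \<nu> cubic_growth_l1])
    show "l1_norm (x + y) ^ 3 \<le> 4 * (l1_norm x ^ 3 + l1_norm y ^ 3)" for x y :: "real ^ 'a"
      by (rule order_trans [OF power_mono [OF l1_norm_triangle l1_norm_nonneg] cube_sum_le]) auto
    show "integrable \<nu> (\<lambda>y. l1_norm (x + y) ^ 3)" for x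
      by (rule cubic_growth_integrable [OF \<nu> cubic_growth_shift [OF cubic_growth_l1]])
  qed (use int in auto)
  also have "\<dots> = 4 * (l1_cube \<mu> + l1_cube \<nu>)"
    using int by (simp add: l1_cube_def \<mu>.prob_space \<nu>.prob_space)
  finally show ?thesis .
qed

section \<open>Rescaled laws\<close>

definition rescale :: "real \<Rightarrow> (real ^ 'n) measure \<Rightarrow> (real ^ 'n) measure" where
  "rescale c \<mu> = distr \<mu> borel (\<lambda>x. c *\<^sub>R x)"

lemma sets_rescale [simp]: "sets (rescale c \<mu>) = sets borel"
  by (simp add: rescale_def)

lemma integral_rescale:
  fixes f :: "real ^ 'n \<Rightarrow> real"
  assumes "sets \<mu> = sets borel" "f \<in> borel_measurable borel"
  shows "(\<integral>x. f x \<partial>rescale c \<mu>) = (\<integral>x. f (c *\<^sub>R x) \<partial>\<mu>)"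
  unfolding rescale_def using assms
  by (subst integral_distr) (auto simp: measurable_cong_sets [OF assms(1) refl])

lemma third_moment_rescale:
  assumes "third_moment \<mu>"
  shows "third_moment (rescale c \<mu>)"
proof -
  interpret prob_space \<mu> using assms by (rule third_momentD)
  have m: "(\<lambda>x. c *\<^sub>R x) \<in> measurable \<mu> borel" by (simp add: third_momentD(5) [OF assms])
  then show ?thesis
    using third_momentD(4) [OF assms]
    by (auto simp: third_moment_def rescale_def integrable_distr_eq power_mult_distrib intro!: prob_space_distr)
qed

lemma centred_law_rescale:
  assumes "centred_law S \<mu>"
  shows "centred_law (c\<^sup>2 *\<^sub>R S) (rescale c \<mu>)"
proof -
  have t: "third_moment \<mu>" using assms by (simp add: centred_law_def)
  have "(\<integral>x. x $ i \<partial>rescale c \<mu>) = 0" for i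
    by (subst integral_rescale [OF third_momentD(2) [OF t]])
      (use assms in \<open>auto simp: centred_law_def\<close>)
  moreover have "(\<integral>x. x $ i * x $ j \<partial>rescale c \<mu>) = (c\<^sup>2 *\<^sub>R S) $ i $ j" for i j
    by (subst integral_rescale [OF third_momentD(2) [OF t]])
      (use assms in \<open>auto simp: centred_law_def power2_eq_square algebra_simps\<close>)
  ultimately show ?thesis using third_moment_rescale [OF t] by (simp add: centred_law_def)
qed

lemma l1_cube_rescale:
  assumes "third_moment \<mu>" "c \<ge> 0"
  shows "l1_cube (rescale c \<mu>) = c ^ 3 * l1_cube \<mu>"
  unfolding l1_cube_def
  by (subst integral_rescale [OF third_momentD(2) [OF assms(1)]])
    (use assms(2) in \<open>auto simp: l1_norm_scaleR power_mult_distrib cubic_growth_measurable [OF cubic_growth_l1]\<close>)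

subsection \<open>A Lindeberg argument with doubling\<close>

text \<open>All that the probabilistic argument uses about \<open>h\<close>. The coefficients
  \<open>a\<close> and \<open>b\<close> stand for the gradient and the Hessian at \<open>x\<close>;
  only their independence of \<open>y\<close> matters, so they are existentially quantified.\<close>

definition cubic_taylor :: "real \<Rightarrow> (real ^ 'n \<Rightarrow> real) \<Rightarrow> bool" where
  "cubic_taylor K h \<longleftrightarrow> h \<in> borel_measurable borel \<and> (\<forall>x. \<exists>(a :: 'n \<Rightarrow> real) b. \<forall>y.
     \<bar>h (x + y) - h x - (\<Sum>i\<in>UNIV. a i * y $ i) - (\<Sum>i\<in>UNIV. \<Sum>j\<in>UNIV. b i j * (y $ i * y $ j)) / 2\<bar>
       \<le> K / 6 * l1_norm y ^ 3)"

lemmas cubic_growth_intros =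
  cubic_growth_add cubic_growth_mult cubic_growth_const cubic_growth_sum
  cubic_growth_component cubic_growth_component2 cubic_growth_l1

text \<open>The expansion about \<open>0\<close> bounds \<open>h\<close> by a quadratic polynomial
  plus a cubic remainder.\<close>

lemma cubic_taylor_growth:
  assumes "cubic_taylor K (h :: real ^ 'n \<Rightarrow> real)"
  shows "cubic_growth h"
proof -
  obtain a b where ab: "\<And>y. \<bar>h (0 + y) - h 0 - (\<Sum>i\<in>UNIV. a i * y $ i)
      - (\<Sum>i\<in>UNIV. \<Sum>j\<in>UNIV. b i j * (y $ i * y $ j)) / 2\<bar> \<le> K / 6 * l1_norm y ^ 3"
    using assms unfolding cubic_taylor_def by meson
  let ?q = "\<lambda>y. h 0 + (\<Sum>i\<in>UNIV. a i * y $ i) + 1 / 2 * (\<Sum>i\<in>UNIV. \<Sum>j\<in>UNIV. b i j * (y $ i * y $ j))"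
  have "cubic_growth ?q" by (intro cubic_growth_intros)
  then obtain C where C: "\<And>y. \<bar>?q y\<bar> \<le> C * (1 + norm y ^ 3)" by (auto simp: cubic_growth_def)
  have "cubic_growth (\<lambda>y :: real ^ 'n. K / 6 * l1_norm y ^ 3)" by (intro cubic_growth_intros)
  then obtain D where D: "\<And>y :: real ^ 'n. \<bar>K / 6 * l1_norm y ^ 3\<bar> \<le> D * (1 + norm y ^ 3)"
    by (auto simp: cubic_growth_def)
  show ?thesis
  proof (rule cubic_growthI)
    show "h \<in> borel_measurable borel" using assms by (simp add: cubic_taylor_def)
    fix y
    let ?r = "h (0 + y) - h 0 - (\<Sum>i\<in>UNIV. a i * y $ i) - (\<Sum>i\<in>UNIV. \<Sum>j\<in>UNIV. b i j * (y $ i * y $ j)) / 2"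
    have "\<bar>h y\<bar> = \<bar>?q y + ?r\<bar>" by simp
    also have "\<dots> \<le> \<bar>?q y\<bar> + \<bar>?r\<bar>" by (rule abs_triangle_ineq)
    also have "\<dots> \<le> C * (1 + norm y ^ 3) + D * (1 + norm y ^ 3)"
      by (intro add_mono C order_trans [OF ab order_trans [OF abs_ge_self D]])
    finally show "\<bar>h y\<bar> \<le> (C + D) * (1 + norm y ^ 3)" by (simp only: distrib_right)
  qed
qed

text \<open>Uniformity over all translates is what makes this closeness stable under convolution
  with a common law.\<close>

definition close :: "(real ^ 'n \<Rightarrow> real) \<Rightarrow> real \<Rightarrow> (real ^ 'n) measure \<Rightarrow> (real ^ 'n) measure \<Rightarrow> bool" where
  "close h d \<mu> \<nu> \<longleftrightarrow> (\<forall>s. \<bar>(\<integral>x. h (s + x) \<partial>\<mu>) - (\<integral>x. h (s + x) \<partial>\<nu>)\<bar> \<le> d)"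

lemma abs_triangle_through: "\<bar>a - c\<bar> \<le> \<bar>a - b\<bar> + \<bar>b - c\<bar>" for a b c :: real
  by linarith

lemma close_refl: "close h 0 \<mu> \<mu>"
  by (simp add: close_def)

lemma close_trans: "close h a \<mu> \<nu> \<Longrightarrow> close h b \<nu> \<rho> \<Longrightarrow> close h (a + b) \<mu> \<rho>"
  unfolding close_def by (blast intro: order_trans [OF abs_triangle_through add_mono])

text \<open>The two factors are replaced one after the other. With the variable of the other factor
  fixed, the difference is an instance of \<open>close\<close> at a shifted point, and averaging
  preserves the bound.\<close>

lemma close_convolution:
  assumes h: "cubic_growth h"
    and third: "third_moment \<mu>" "third_moment \<nu>" "third_moment \<mu>'" "third_moment \<nu>'"
    and 1: "close h a \<mu> \<mu>'" and 2: "close h b \<nu> \<nu>'"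
  shows "close h (a + b) (\<mu> \<star> \<nu>) (\<mu>' \<star> \<nu>')"
proof (rule close_trans)
  interpret \<nu>: prob_space \<nu> using third(2) by (rule third_momentD)
  interpret \<mu>': prob_space \<mu>' using third(3) by (rule third_momentD)
  note hs = cubic_growth_shift [OF h]
  show "close h a (\<mu> \<star> \<nu>) (\<mu>' \<star> \<nu>)"
    unfolding close_def
  proof
    fix s
    let ?d = "\<lambda>y. (\<integral>x. h (s + (x + y)) \<partial>\<mu>) - (\<integral>x. h (s + (x + y)) \<partial>\<mu>')"
    note i = integrable_convolution_inner' [OF third(1,2) hs] integrable_convolution_inner' [OF third(3,2) hs]
    have b: "\<bar>?d y\<bar> \<le> a" for y
      using 1 [unfolded close_def, rule_format, of "s + y"] by (simp add: add_ac)
    have "(\<integral>x. h (s + x) \<partial>(\<mu> \<star> \<nu>)) - (\<integral>x. h (s + x) \<partial>(\<mu>' \<star> \<nu>)) = (\<integral>y. ?d y \<partial>\<nu>)"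
      by (simp add: integral_convolution' [OF third(1,2) hs] integral_convolution' [OF third(3,2) hs] i)
    also have "\<bar>\<dots>\<bar> \<le> (\<integral>y. \<bar>?d y\<bar> \<partial>\<nu>)" by (rule integral_abs_bound)
    also have "\<dots> \<le> (\<integral>y. a \<partial>\<nu>)"
      using i b by (intro integral_mono) auto
    finally show "\<bar>(\<integral>x. h (s + x) \<partial>(\<mu> \<star> \<nu>)) - (\<integral>x. h (s + x) \<partial>(\<mu>' \<star> \<nu>))\<bar> \<le> a"
      by (simp add: \<nu>.prob_space)
  qed
  show "close h b (\<mu>' \<star> \<nu>) (\<mu>' \<star> \<nu>')"
    unfolding close_def
  proof
    fix s
    let ?d = "\<lambda>x. (\<integral>y. h (s + (x + y)) \<partial>\<nu>) - (\<integral>y. h (s + (x + y)) \<partial>\<nu>')"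
    note i = integrable_convolution_inner [OF third(3,2) hs] integrable_convolution_inner [OF third(3,4) hs]
    have b: "\<bar>?d x\<bar> \<le> b" for x
      using 2 [unfolded close_def, rule_format, of "s + x"] by (simp add: add_ac)
    have "(\<integral>x. h (s + x) \<partial>(\<mu>' \<star> \<nu>)) - (\<integral>x. h (s + x) \<partial>(\<mu>' \<star> \<nu>')) = (\<integral>x. ?d x \<partial>\<mu>')"
      by (simp add: integral_convolution [OF third(3,2) hs] integral_convolution [OF third(3,4) hs] i)
    also have "\<bar>\<dots>\<bar> \<le> (\<integral>x. \<bar>?d x\<bar> \<partial>\<mu>')" by (rule integral_abs_bound)
    also have "\<dots> \<le> (\<integral>x. b \<partial>\<mu>')"
      using i b by (intro integral_mono) auto
    finally show "\<bar>(\<integral>x. h (s + x) \<partial>(\<mu>' \<star> \<nu>)) - (\<integral>x. h (s + x) \<partial>(\<mu>' \<star> \<nu>'))\<bar> \<le> b"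
      by (simp add: \<mu>'.prob_space)
  qed
qed

text \<open>Lindeberg's exchange: under a centred law with covariance \<open>S\<close> the linear
  part integrates to zero and the quadratic part depends on \<open>S\<close> alone, so only the two
  cubic remainders survive.\<close>

lemma close_same_covariance:
  assumes h: "cubic_taylor K h" and \<mu>: "centred_law S \<mu>" and \<nu>: "centred_law S \<nu>"
  shows "close h (K / 6 * (l1_cube \<mu> + l1_cube \<nu>)) \<mu> \<nu>"
  unfolding close_def
proof
  fix s
  obtain a b where ab: "\<And>y. \<bar>h (s + y) - h s - (\<Sum>i\<in>UNIV. a i * y $ i)
      - (\<Sum>i\<in>UNIV. \<Sum>j\<in>UNIV. b i j * (y $ i * y $ j)) / 2\<bar> \<le> K / 6 * l1_norm y ^ 3"
    using h unfolding cubic_taylor_def by meson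
  have "\<bar>(\<integral>y. h (s + y) \<partial>\<rho>) - h s - (\<Sum>i\<in>UNIV. \<Sum>j\<in>UNIV. b i j * S $ i $ j) / 2\<bar> \<le> K / 6 * l1_cube \<rho>"
    if \<rho>: "centred_law S \<rho>" for \<rho>
  proof -
    have t: "third_moment \<rho>" using \<rho> by (simp add: centred_law_def)
    interpret prob_space \<rho> using t by (rule third_momentD)
    note int = cubic_growth_integrable [OF t cubic_growth_shift [OF cubic_taylor_growth [OF h]]]
      cubic_growth_integrable [OF t cubic_growth_component]
      cubic_growth_integrable [OF t cubic_growth_component2]
      cubic_growth_integrable [OF t cubic_growth_l1]
    let ?r = "\<lambda>y. h (s + y) - h s - (\<Sum>i\<in>UNIV. a i * y $ i)
      - (\<Sum>i\<in>UNIV. \<Sum>j\<in>UNIV. b i j * (y $ i * y $ j)) / 2"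
    have r: "integrable \<rho> ?r"
      using int by auto
    have "(\<integral>y. ?r y \<partial>\<rho>) = (\<integral>y. h (s + y) \<partial>\<rho>) - h s - (\<Sum>i\<in>UNIV. \<Sum>j\<in>UNIV. b i j * S $ i $ j) / 2"
      using int \<rho> by (simp add: centred_law_def prob_space)
    then have "\<bar>(\<integral>y. h (s + y) \<partial>\<rho>) - h s - (\<Sum>i\<in>UNIV. \<Sum>j\<in>UNIV. b i j * S $ i $ j) / 2\<bar> = \<bar>\<integral>y. ?r y \<partial>\<rho>\<bar>"
      by simp
    also have "\<dots> \<le> (\<integral>y. \<bar>?r y\<bar> \<partial>\<rho>)" by (rule integral_abs_bound)
    also have "\<dots> \<le> (\<integral>y. K / 6 * l1_norm y ^ 3 \<partial>\<rho>)"
      using int(4) by (intro integral_mono integrable_abs r ab integrable_mult_right)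
    finally show ?thesis by (simp add: l1_cube_def)
  qed
  from this [OF \<mu>] this [OF \<nu>]
  show "\<bar>(\<integral>x. h (s + x) \<partial>\<mu>) - (\<integral>x. h (s + x) \<partial>\<nu>)\<bar> \<le> K / 6 * (l1_cube \<mu> + l1_cube \<nu>)"
    unfolding distrib_left by linarith
qed

text \<open>Stability of index two: under convolution the squares of the scales add.\<close>

definition stable_law :: "(real ^ 'n) measure \<Rightarrow> bool" where
  "stable_law \<gamma> \<longleftrightarrow> (\<forall>a\<ge>0. \<forall>b\<ge>0. (rescale a \<gamma> \<star> rescale b \<gamma>) = rescale (sqrt (a\<^sup>2 + b\<^sup>2)) \<gamma>)"

text \<open>The fixed point of the recursion in \<open>close_stable_law\<close>, divided by
  \<open>K * l1_cube \<mu>\<close>; numerically about 2.18.\<close>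

definition lindeberg_constant :: real where
  "lindeberg_constant = (1 + 2 * sqrt 2) / (6 * (1 - 1 / sqrt 2))"

text \<open>The factor \<open>8\<close> is the cube of the bound \<open>2\<close> on the l1 norm of
  one ball's vector. With \<open>1 / s = s / 2\<close> the second inequality reduces to
  \<open>73 * s \<le> 106\<close>, so a decimal bound on \<open>sqrt 2\<close> suffices.\<close>

lemma lindeberg_constant_bound: "0 \<le> lindeberg_constant" "lindeberg_constant * 8 \<le> 19"
proof -
  define s :: real where "s = sqrt 2"
  have s2: "s * s = 2" by (simp add: s_def)
  have s: "7 / 5 \<le> s" "s \<le> 141422 / 100000"
    using real_le_rsqrt [of "7 / 5" 2] real_le_lsqrt [of "141422 / 100000" 2]
    by (simp_all add: s_def power2_eq_square)
  have "1 / s = s / 2" using s2 s by (simp add: field_simps)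
  then have eq: "lindeberg_constant = (1 + 2 * s) / (6 * (1 - s / 2))"
    by (simp add: lindeberg_constant_def s_def)
  show "0 \<le> lindeberg_constant" "lindeberg_constant * 8 \<le> 19"
    unfolding eq using s by (simp_all add: field_simps)
qed

text \<open>
  Splitting a summand of scale \<open>c\<close> into two of scale \<open>c / sqrt 2\<close> costs \<open>\<kappa> * c ^ 3\<close> with
  \<open>\<kappa> = K / 6 * (1 + 2 * sqrt 2) * l1_cube \<mu>\<close>, and afterwards the bound \<open>A * c ^ 3\<close> is used twice
  at the smaller scale. So \<open>A\<close> may be replaced by \<open>\<kappa> + A / sqrt 2\<close>, and iterating leads to the
  fixed point of this contraction, in which the third moment of \<open>\<gamma>\<close> no longer appears.
\<close>

lemma close_stable_law:
  assumes h: "cubic_taylor K h" and K: "K \<ge> 0" and \<mu>: "centred_law S \<mu>" and \<gamma>: "centred_law S \<gamma>"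
    and stable: "stable_law \<gamma>" and c: "c \<ge> 0"
  shows "close h (lindeberg_constant * K * l1_cube \<mu> * c ^ 3) (rescale c \<mu>) (rescale c \<gamma>)"
proof -
  have t\<mu>: "third_moment \<mu>" and t\<gamma>: "third_moment \<gamma>" using \<mu> \<gamma> by (auto simp: centred_law_def)
  define \<kappa> where "\<kappa> = K / 6 * (1 + 2 * sqrt 2) * l1_cube \<mu>"
  define q :: real where "q = 1 / sqrt 2"
  have q: "0 < q" "q < 1" "q * q = 1 / 2" by (auto simp: q_def)
  \<comment> \<open>Since \<open>q * q = 1 / 2\<close>, the sum of two independent copies at scale
    \<open>c * q\<close> has the covariance of one copy at scale \<open>c\<close>.\<close>
  have split: "close h (\<kappa> * c ^ 3) (rescale c \<mu>) (rescale (c * q) \<mu> \<star> rescale (c * q) \<mu>)" if "c \<ge> 0" for c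
  proof -
    let ?\<nu> = "rescale (c * q) \<mu> \<star> rescale (c * q) \<mu>"
    have "(c * q)\<^sup>2 *\<^sub>R S + (c * q)\<^sup>2 *\<^sub>R S = c\<^sup>2 *\<^sub>R S"
      using q(3) by (simp add: scaleR_add_left [symmetric] power_mult_distrib power2_eq_square)
    then have "centred_law (c\<^sup>2 *\<^sub>R S) ?\<nu>"
      using centred_law_convolution [OF centred_law_rescale [OF \<mu>] centred_law_rescale [OF \<mu>]] by metis
    from close_same_covariance [OF h centred_law_rescale [OF \<mu>] this]
    have "close h (K / 6 * (l1_cube (rescale c \<mu>) + l1_cube ?\<nu>)) (rescale c \<mu>) ?\<nu>" .
    moreover have "K / 6 * (l1_cube (rescale c \<mu>) + l1_cube ?\<nu>) \<le> \<kappa> * c ^ 3"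
    proof -
      have "l1_cube ?\<nu> \<le> 4 * (l1_cube (rescale (c * q) \<mu>) + l1_cube (rescale (c * q) \<mu>))"
        by (intro l1_cube_convolution third_moment_rescale t\<mu>)
      also have "\<dots> = 8 * q ^ 3 * c ^ 3 * l1_cube \<mu>"
        using l1_cube_rescale [OF t\<mu>, of "c * q"] q that by (simp add: power_mult_distrib)
      also have "8 * q ^ 3 = 2 * sqrt 2"
        using q(3) by (simp add: power3_eq_cube) (simp add: q_def field_simps)
      finally have "l1_cube (rescale c \<mu>) + l1_cube ?\<nu> \<le> (1 + 2 * sqrt 2) * l1_cube \<mu> * c ^ 3"
        using l1_cube_rescale [OF t\<mu> that] by (simp add: algebra_simps)
      from mult_left_mono [OF this, of "K / 6"] show ?thesis
        using K by (simp add: \<kappa>_def mult.assoc)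
    qed
    ultimately show ?thesis unfolding close_def by (meson order_trans)
  qed
  define P where "P A \<longleftrightarrow> (\<forall>c\<ge>0. close h (A * c ^ 3) (rescale c \<mu>) (rescale c \<gamma>))" for A
  \<comment> \<open>A direct exchange with \<open>\<gamma>\<close> gives a finite starting value,
    however large; the iteration makes its influence vanish.\<close>
  have base: "P (K / 6 * (l1_cube \<mu> + l1_cube \<gamma>))"
    unfolding P_def
  proof (intro allI impI)
    fix c :: real assume "c \<ge> 0"
    have "close h (K / 6 * (l1_cube (rescale c \<mu>) + l1_cube (rescale c \<gamma>))) (rescale c \<mu>) (rescale c \<gamma>)"
      by (rule close_same_covariance [OF h centred_law_rescale [OF \<mu>] centred_law_rescale [OF \<gamma>]])
    then show "close h (K / 6 * (l1_cube \<mu> + l1_cube \<gamma>) * c ^ 3) (rescale c \<mu>) (rescale c \<gamma>)"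
      using l1_cube_rescale [OF t\<mu> \<open>c \<ge> 0\<close>] l1_cube_rescale [OF t\<gamma> \<open>c \<ge> 0\<close>]
      by (simp add: algebra_simps add_divide_distrib)
  qed
  have step: "P (\<kappa> + A * q)" if "P A" for A
    unfolding P_def
  proof (intro allI impI)
    fix c :: real assume "c \<ge> 0"
    have "close h (A * (c * q) ^ 3) (rescale (c * q) \<mu>) (rescale (c * q) \<gamma>)"
      using \<open>P A\<close> \<open>c \<ge> 0\<close> q(1) by (simp add: P_def)
    from close_convolution [OF cubic_taylor_growth [OF h] _ _ _ _ this this]
    have "close h (A * (c * q) ^ 3 + A * (c * q) ^ 3)
        (rescale (c * q) \<mu> \<star> rescale (c * q) \<mu>) (rescale (c * q) \<gamma> \<star> rescale (c * q) \<gamma>)"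
      by (simp add: third_moment_rescale t\<mu> t\<gamma>)
    moreover have "(rescale (c * q) \<gamma> \<star> rescale (c * q) \<gamma>) = rescale c \<gamma>"
    proof -
      have "(c * q)\<^sup>2 + (c * q)\<^sup>2 = c\<^sup>2"
        using q(3) by (simp add: power_mult_distrib power2_eq_square)
      then show ?thesis using stable \<open>c \<ge> 0\<close> q(1) by (simp add: stable_law_def)
    qed
    ultimately have "close h (\<kappa> * c ^ 3 + (A * (c * q) ^ 3 + A * (c * q) ^ 3)) (rescale c \<mu>) (rescale c \<gamma>)"
      using close_trans [OF split [OF \<open>c \<ge> 0\<close>]] by simp
    \<comment> \<open>The two smaller copies contribute the factor \<open>2 * q ^ 3 = q < 1\<close>,
      hence a contraction.\<close>
    moreover have "\<kappa> * c ^ 3 + (A * (c * q) ^ 3 + A * (c * q) ^ 3) = (\<kappa> + A * q) * c ^ 3"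
      using q(3) by (simp add: power3_eq_cube algebra_simps)
    ultimately show "close h ((\<kappa> + A * q) * c ^ 3) (rescale c \<mu>) (rescale c \<gamma>)" by simp
  qed
  define F where "F = \<kappa> / (1 - q)"
  have fixpoint: "\<kappa> + F * q = F" using q(2) by (simp add: F_def field_simps)
  define A where "A = K / 6 * (l1_cube \<mu> + l1_cube \<gamma>)"
  have iter: "P (F + (A - F) * q ^ k)" for k
  proof (induction k)
    case 0
    show ?case using base by (simp add: A_def)
  next
    case (Suc k)
    have "\<kappa> + (F + (A - F) * q ^ k) * q = F + (A - F) * q ^ Suc k"
      using fixpoint by (simp add: algebra_simps)
    then show ?case using step [OF Suc] by simp
  qed
  \<comment> \<open>For fixed \<open>c\<close> and \<open>s\<close> the bound holds for every
    iterate and therefore, being non-strict, also for their limit \<open>F\<close>.\<close>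
  have "P F"
    unfolding P_def close_def
  proof (intro allI impI)
    fix c :: real and s assume c: "0 \<le> c"
    have "(\<lambda>k. (F + (A - F) * q ^ k) * c ^ 3) \<longlonglongrightarrow> (F + (A - F) * 0) * c ^ 3"
      by (intro tendsto_intros LIMSEQ_power_zero) (use q in auto)
    then show "\<bar>(\<integral>x. h (s + x) \<partial>rescale c \<mu>) - (\<integral>x. h (s + x) \<partial>rescale c \<gamma>)\<bar> \<le> F * c ^ 3"
      using iter c by (intro LIMSEQ_le_const) (auto simp: P_def close_def)
  qed
  moreover have "F = lindeberg_constant * K * l1_cube \<mu>"
    by (simp add: F_def \<kappa>_def lindeberg_constant_def q_def)
  ultimately show ?thesis using c by (simp add: P_def)
qed

section \<open>Sums of independent copies as convolution powers\<close>

primrec conv_power :: "(real ^ 'n) measure \<Rightarrow> nat \<Rightarrow> (real ^ 'n) measure" where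
  "conv_power \<mu> 0 = return borel 0"
| "conv_power \<mu> (Suc k) = (conv_power \<mu> k \<star> \<mu>)"

lemma centred_law_return: "centred_law 0 (return borel 0)"
  by (auto simp: centred_law_def third_moment_def prob_space_return integral_return nn_integral_return
      intro!: integrableI_bounded)

lemma centred_law_conv_power:
  assumes "centred_law S \<mu>"
  shows "centred_law (real k *\<^sub>R S) (conv_power \<mu> k)"
proof (induction k)
  case 0
  show ?case by (simp add: centred_law_return)
next
  case (Suc k)
  have "real k *\<^sub>R S + S = real (Suc k) *\<^sub>R S" by (simp add: algebra_simps)
  then show ?case using centred_law_convolution [OF Suc assms] by simp
qed

text \<open>Telescoping: the summands are exchanged one at a time, each at cost
  \<open>d\<close>.\<close>

lemma close_conv_power:
  assumes "cubic_growth h" "centred_law S \<mu>" "centred_law T \<nu>" "close h d \<mu> \<nu>"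
  shows "close h (real k * d) (conv_power \<mu> k) (conv_power \<nu> k)"
proof (induction k)
  case 0
  show ?case by (simp add: close_refl)
next
  case (Suc k)
  have "close h (real k * d + d) (conv_power \<mu> k \<star> \<mu>) (conv_power \<nu> k \<star> \<nu>)"
    using centred_law_conv_power [OF assms(2), of k] centred_law_conv_power [OF assms(3), of k] assms
    by (intro close_convolution [OF assms(1)] Suc) (auto simp: centred_law_def)
  then show ?case by (simp add: algebra_simps)
qed

text \<open>Each further factor adds \<open>c\<^sup>2\<close> to the squared scale. For
  \<open>k = 0\<close> both sides are the point mass at the origin.\<close>

lemma conv_power_stable_law:
  assumes "stable_law \<gamma>" "prob_space \<gamma>" "sets \<gamma> = sets borel" "0 \<le> c"
  shows "conv_power (rescale c \<gamma>) k = rescale (sqrt (real k) * c) \<gamma>"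
proof (induction k)
  case 0
  interpret prob_space \<gamma> by fact
  show ?case by (simp add: rescale_def)
next
  case (Suc k)
  have "(sqrt (real k) * c)\<^sup>2 + c\<^sup>2 = (sqrt (real (Suc k)) * c)\<^sup>2"
    by (simp add: algebra_simps)
  then have "(rescale (sqrt (real k) * c) \<gamma> \<star> rescale c \<gamma>) = rescale \<bar>sqrt (real (Suc k)) * c\<bar> \<gamma>"
    using assms(1,4) by (simp add: stable_law_def del: of_nat_Suc)
  then show ?case using Suc assms(4) by simp
qed

subsection \<open>Gaussian laws\<close>

definition gauss_density :: "real ^ 'n \<Rightarrow> ennreal" where
  "gauss_density x = ennreal (\<Prod>i\<in>UNIV. std_normal_density (x $ i))"

text \<open>The density is radial, so identities between products of densities reduce to identities
  between squared norms.\<close>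

lemma gauss_density_eq:
  "gauss_density (x :: real ^ 'n) = ennreal ((1 / sqrt (2 * pi)) ^ CARD('n) * exp (- (norm x)\<^sup>2 / 2))"
proof -
  have "(norm x)\<^sup>2 = (\<Sum>i\<in>UNIV. (x $ i)\<^sup>2)"
    unfolding power2_norm_eq_inner by (simp add: inner_vec_def power2_eq_square)
  then have "- (norm x)\<^sup>2 / 2 = (\<Sum>i\<in>UNIV. - (x $ i)\<^sup>2 / 2)"
    by (simp add: sum_negf sum_divide_distrib)
  then show ?thesis
    by (simp add: gauss_density_def std_normal_density_def prod.distrib exp_sum power_divide prod_dividef)
qed

lemma borel_measurable_gauss_density [measurable]: "gauss_density \<in> borel_measurable borel"
  unfolding gauss_density_def [abs_def] by measurable

lemma std_gaussian_eq: "std_gaussian = density lborel gauss_density"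
  by (simp add: std_gaussian_def gauss_density_def [abs_def])

lemma sets_std_gaussian [measurable_cong, simp]: "sets std_gaussian = sets borel"
  by (simp add: std_gaussian_eq)

lemma nn_integral_std_gaussian:
  "f \<in> borel_measurable borel \<Longrightarrow> (\<integral>\<^sup>+x. f x \<partial>std_gaussian) = (\<integral>\<^sup>+x. gauss_density x * f x \<partial>lborel)"
  by (simp add: std_gaussian_eq nn_integral_density)

section \<open>Rotation invariance of the standard Gaussian law\<close>

lemma nn_integral_lborel_affine:
  fixes f :: "real ^ 'n \<Rightarrow> ennreal"
  assumes [measurable]: "f \<in> borel_measurable borel" and c: "c \<noteq> 0"
  shows "(\<integral>\<^sup>+x. f x \<partial>lborel) = ennreal (\<bar>c\<bar> ^ CARD('n)) * (\<integral>\<^sup>+x. f (t + c *\<^sub>R x) \<partial>lborel)"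
  by (subst lborel_affine [OF c, of t])
    (simp add: nn_integral_density nn_integral_distr nn_integral_cmult)

text \<open>By \<open>a\<^sup>2 + b\<^sup>2 = 1\<close> the sum of squared norms on the left is
  \<open>(u \<bullet> u - 2 * b * (u \<bullet> y) + y \<bullet> y) / a\<^sup>2\<close>, which is
  symmetric in \<open>u\<close> and \<open>y\<close>.\<close>

lemma gauss_density_rotate:
  assumes a: "a \<noteq> 0" and ab: "a\<^sup>2 + b\<^sup>2 = 1"
  shows "gauss_density ((1 / a) *\<^sub>R (u - b *\<^sub>R y)) * gauss_density y =
    gauss_density u * gauss_density ((1 / a) *\<^sub>R (y - b *\<^sub>R u))"
proof -
  have b2: "b\<^sup>2 = 1 - a\<^sup>2" using ab by simp
  have "(norm ((1 / a) *\<^sub>R (u - b *\<^sub>R y)))\<^sup>2 + (norm y)\<^sup>2 = (norm u)\<^sup>2 + (norm ((1 / a) *\<^sub>R (y - b *\<^sub>R u)))\<^sup>2"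
  proof -
    have "(norm ((1 / a) *\<^sub>R (v - b *\<^sub>R w)))\<^sup>2 = (v \<bullet> v - 2 * b * (v \<bullet> w) + b\<^sup>2 * (w \<bullet> w)) / a\<^sup>2" for v w :: "real ^ 'a"
    proof -
      have "(norm (v - b *\<^sub>R w))\<^sup>2 = v \<bullet> v - 2 * b * (v \<bullet> w) + b\<^sup>2 * (w \<bullet> w)"
        unfolding power2_norm_eq_inner
        by (simp add: inner_diff_left inner_diff_right inner_commute [of w v] power2_eq_square algebra_simps)
      then show ?thesis by (simp add: power_divide)
    qed
    note eq = this
    show ?thesis
      unfolding eq unfolding power2_norm_eq_inner b2 inner_commute [of y u]
      using a by (simp add: field_simps)
  qed
  moreover have "gauss_density v * gauss_density w = ennreal (((1 / sqrt (2 * pi)) ^ CARD('a))\<^sup>2 * exp (- ((norm v)\<^sup>2 + (norm w)\<^sup>2) / 2))"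
    for v w :: "real ^ 'a"
    unfolding gauss_density_eq minus_add_distrib add_divide_distrib exp_add power2_eq_square [of "_ ^ CARD('a)"]
    by (subst ennreal_mult [symmetric]) (simp_all only: mult_ac, auto)
  ultimately show ?thesis by (simp only: )
qed

text \<open>The assumption on \<open>std_gaussian\<close> says that the density integrates to one;
  the power of \<open>\<bar>a\<bar>\<close> is the Jacobian.\<close>

lemma nn_integral_gauss_density_affine:
  fixes v :: "real ^ 'n"
  assumes "prob_space (std_gaussian :: (real ^ 'n) measure)" and a: "a \<noteq> 0"
  shows "(\<integral>\<^sup>+y. gauss_density ((1 / a) *\<^sub>R (y - v)) \<partial>lborel) = ennreal (\<bar>a\<bar> ^ CARD('n))"
proof -
  interpret prob_space "std_gaussian :: (real ^ 'n) measure" by fact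
  have "(\<integral>\<^sup>+x. gauss_density (x :: real ^ 'n) \<partial>lborel) = (\<integral>\<^sup>+x. 1 \<partial>(std_gaussian :: (real ^ 'n) measure))"
    by (subst nn_integral_std_gaussian) auto
  also have "\<dots> = 1" by (simp add: emeasure_space_1)
  finally have "(\<integral>\<^sup>+x. gauss_density (x :: real ^ 'n) \<partial>lborel) = 1" .
  then show ?thesis
    using a by (subst nn_integral_lborel_affine [OF _ a, of _ v]) auto
qed

text \<open>
  Substituting \<open>u = a x + b y\<close> for \<open>x\<close> and then integrating out \<open>y\<close> replaces an appeal to the
  rotation invariance of Lebesgue measure on the product space.
\<close>

lemma nn_integral_std_gaussian_rotate:
  fixes f :: "real ^ 'n \<Rightarrow> ennreal"
  assumes P: "prob_space (std_gaussian :: (real ^ 'n) measure)"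
    and [measurable]: "f \<in> borel_measurable borel" and a: "a \<noteq> 0" and ab: "a\<^sup>2 + b\<^sup>2 = 1"
  shows "(\<integral>\<^sup>+y. \<integral>\<^sup>+x. f (a *\<^sub>R x + b *\<^sub>R y) \<partial>std_gaussian \<partial>std_gaussian) = (\<integral>\<^sup>+x. f x \<partial>std_gaussian)"
proof -
  \<comment> \<open>The Jacobian is carried as a factor on both sides and cancelled only at the end,
    being nonzero and finite.\<close>
  let ?c = "ennreal (\<bar>a\<bar> ^ CARD('n))"
  have c: "?c \<noteq> 0" "?c \<noteq> \<top>" using a by auto
  interpret prob_space "std_gaussian :: (real ^ 'n) measure" by fact
  have inner: "?c * (\<integral>\<^sup>+x. f (a *\<^sub>R x + b *\<^sub>R y) \<partial>std_gaussian) =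
      (\<integral>\<^sup>+u. gauss_density ((1 / a) *\<^sub>R (u - b *\<^sub>R y)) * f u \<partial>lborel)" for y
    using a by (subst nn_integral_std_gaussian, measurable)
      (subst nn_integral_lborel_affine [OF _ a, of _ "b *\<^sub>R y"], auto simp: add.commute)
  have "?c * (\<integral>\<^sup>+y. \<integral>\<^sup>+x. f (a *\<^sub>R x + b *\<^sub>R y) \<partial>std_gaussian \<partial>std_gaussian) =
      (\<integral>\<^sup>+y. ?c * (\<integral>\<^sup>+x. f (a *\<^sub>R x + b *\<^sub>R y) \<partial>std_gaussian) \<partial>std_gaussian)"
    by (subst nn_integral_cmult) auto
  also have "\<dots> = (\<integral>\<^sup>+y. \<integral>\<^sup>+u. gauss_density ((1 / a) *\<^sub>R (u - b *\<^sub>R y)) * f u \<partial>lborel \<partial>std_gaussian)"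
    unfolding inner ..
  also have "\<dots> = (\<integral>\<^sup>+y. \<integral>\<^sup>+u. f u * (gauss_density ((1 / a) *\<^sub>R (u - b *\<^sub>R y)) * gauss_density y) \<partial>lborel \<partial>lborel)"
    by (subst nn_integral_std_gaussian, measurable)
      (subst nn_integral_cmult [symmetric], auto intro!: nn_integral_cong simp: mult_ac)
  also have "\<dots> = (\<integral>\<^sup>+y. \<integral>\<^sup>+u. f u * gauss_density u * gauss_density ((1 / a) *\<^sub>R (y - b *\<^sub>R u)) \<partial>lborel \<partial>lborel)"
    unfolding gauss_density_rotate [OF a ab] by (simp add: mult.assoc)
  also have "\<dots> = (\<integral>\<^sup>+u. \<integral>\<^sup>+y. f u * gauss_density u * gauss_density ((1 / a) *\<^sub>R (y - b *\<^sub>R u)) \<partial>lborel \<partial>lborel)"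
    by (rule lborel_pair.Fubini') measurable
  also have "\<dots> = (\<integral>\<^sup>+u. f u * gauss_density u * ?c \<partial>lborel)"
    by (subst nn_integral_cmult) (auto simp: nn_integral_gauss_density_affine [OF P a])
  also have "\<dots> = ?c * (\<integral>\<^sup>+u. f u \<partial>std_gaussian)"
    by (subst nn_integral_multc, measurable)
      (subst nn_integral_std_gaussian, auto simp: mult_ac)
  finally show ?thesis using c by (simp add: ennreal_mult_cancel_left)
qed

text \<open>Half of the exponent absorbs the cube: \<open>r ^ 3 * exp (- r\<^sup>2 / 2) \<le> 33 *
  exp (- r\<^sup>2 / 4)\<close>, and the right side is, up to a constant, a Gaussian density
  rescaled by \<open>sqrt 2\<close>.\<close>

lemma third_moment_std_gaussian:
  assumes P: "prob_space (std_gaussian :: (real ^ 'n) measure)"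
  shows "third_moment (std_gaussian :: (real ^ 'n) measure)"
proof -
  let ?q = "sqrt 2"
  have bound: "gauss_density x * ennreal (norm x ^ 3) \<le> 33 * gauss_density ((1 / ?q) *\<^sub>R (x - 0))" for x :: "real ^ 'n"
  proof -
    define r where "r = norm x"
    let ?z = "r\<^sup>2 / 4"
    have "r ^ 3 \<le> 1 + r ^ 4"
    proof (cases "r \<le> 1")
      case True
      then show ?thesis using power_le_one [of r 3] by (simp add: r_def add_increasing2)
    next
      case False
      then show ?thesis using power_increasing [of 3 4 r] by linarith
    qed
    \<comment> \<open>Rewriting \<open>r ^ 4\<close> through the quadratic Taylor term of
      \<open>exp ?z\<close> explains the constant \<open>33 = 1 + 32\<close>.\<close>
    also have "\<dots> = 1 + 32 * (?z\<^sup>2 / 2)" by (simp add: power2_eq_square power4_eq_xxxx)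
    also have "\<dots> \<le> 33 * exp ?z"
    proof -
      have "1 + ?z + ?z\<^sup>2 / 2 \<le> exp ?z" by (rule exp_lower_Taylor_quadratic) simp
      moreover have "1 \<le> exp ?z" by simp
      moreover have "0 \<le> ?z" by simp
      ultimately show ?thesis by linarith
    qed
    finally have "exp (- r\<^sup>2 / 2) * r ^ 3 \<le> exp (- r\<^sup>2 / 2) * (33 * exp ?z)"
      by (rule mult_left_mono) simp
    also have "\<dots> = 33 * exp (- r\<^sup>2 / 2 + ?z)"
      by (simp only: exp_add mult.left_commute)
    also have "- r\<^sup>2 / 2 + ?z = - (r / ?q)\<^sup>2 / 2"
      by (simp add: power_divide)
    finally have "exp (- r\<^sup>2 / 2) * r ^ 3 \<le> 33 * exp (- (r / ?q)\<^sup>2 / 2)" .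
    note exp_bound = this
    define k where "k = (1 / sqrt (2 * pi)) ^ CARD('n)"
    have "k \<ge> 0" by (simp add: k_def)
    have "gauss_density x * ennreal (norm x ^ 3) = ennreal (k * exp (- r\<^sup>2 / 2) * r ^ 3)"
      unfolding gauss_density_eq r_def k_def by (rule ennreal_mult [symmetric]) auto
    also have "\<dots> \<le> ennreal (33 * (k * exp (- (r / ?q)\<^sup>2 / 2)))"
      using mult_left_mono [OF exp_bound \<open>k \<ge> 0\<close>] by (intro ennreal_leI) (simp add: mult_ac)
    also have "\<dots> = 33 * ennreal (k * exp (- (r / ?q)\<^sup>2 / 2))"
      using \<open>k \<ge> 0\<close> by (subst ennreal_mult) auto
    also have "ennreal (k * exp (- (r / ?q)\<^sup>2 / 2)) = gauss_density ((1 / ?q) *\<^sub>R (x - 0))"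
      by (simp add: gauss_density_eq r_def k_def power_divide)
    finally show ?thesis .
  qed
  have "(\<integral>\<^sup>+x. ennreal (norm (x :: real ^ 'n) ^ 3) \<partial>std_gaussian) \<le>
      (\<integral>\<^sup>+x. 33 * gauss_density ((1 / ?q) *\<^sub>R (x - 0 :: real ^ 'n)) \<partial>lborel)"
    by (subst nn_integral_std_gaussian, measurable) (intro nn_integral_mono bound)
  also have "\<dots> = 33 * ennreal (\<bar>?q\<bar> ^ CARD('n))"
    by (subst nn_integral_cmult) (use nn_integral_gauss_density_affine [OF P, of ?q 0] in auto)
  also have "\<dots> < \<top>" by (simp add: ennreal_mult_less_top)
  finally have "integrable (std_gaussian :: (real ^ 'n) measure) (\<lambda>x. norm x ^ 3)"
    by (intro integrableI_bounded) auto
  then show ?thesis using P by (simp add: third_moment_def)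
qed

section \<open>Centred Gaussian laws with arbitrary covariance matrix\<close>

lemma borel_measurable_matrix_vector_mult [measurable]:
  "(\<lambda>x. (A :: real ^ 'n ^ 'n) *v x) \<in> borel_measurable borel"
  by (intro borel_measurable_continuous_onI matrix_vector_mult_linear_continuous_on)

lemma borel_measurable_vec_nth' [measurable (raw)]:
  "f \<in> borel_measurable M \<Longrightarrow> (\<lambda>x. f x $ i :: real) \<in> borel_measurable M"
  by (rule measurable_compose) auto

text \<open>Everything is transported from the standard Gaussian along \<open>A\<close>, which may
  be singular: linearity carries over the rotation identity, boundedness the third moment, and the
  symmetry under \<open>uminus\<close> the vanishing mean.\<close>

lemma
  fixes S :: "real ^ 'n ^ 'n"
  assumes N: "is_MVN0 S \<nu>" and prob: "prob_space \<nu>"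
  shows centred_law_MVN0: "centred_law S \<nu>" and stable_law_MVN0: "stable_law \<nu>"
proof -
  obtain A where \<nu>: "\<nu> = distr std_gaussian borel (\<lambda>x. (A :: real ^ 'n ^ 'n) *v x)"
    and cov: "covariance_matrix \<nu> (\<lambda>x. x) = S"
    using N by (auto simp: is_MVN0_def centred_gaussian_def)
  let ?G = "std_gaussian :: (real ^ 'n) measure"
  \<comment> \<open>\<open>\<nu>\<close> is an image of \<open>std_gaussian\<close>, so the two have
    the same total mass.\<close>
  have P: "prob_space ?G"
  proof
    have "emeasure \<nu> (space \<nu>) = 1" using prob by (rule prob_space.emeasure_space_1)
    then show "emeasure ?G (space ?G) = 1" by (simp add: \<nu> emeasure_distr)
  qed
  interpret G: prob_space ?G by (rule P)
  note third = third_moment_std_gaussian [OF P]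
  have nn: "(\<integral>\<^sup>+x. f x \<partial>rescale c \<nu>) = (\<integral>\<^sup>+x. f (c *\<^sub>R (A *v x)) \<partial>?G)"
    if [measurable]: "f \<in> borel_measurable borel" for c and f :: "real ^ 'n \<Rightarrow> ennreal"
    by (simp add: rescale_def \<nu> nn_integral_distr)
  show "stable_law \<nu>"
    unfolding stable_law_def
  proof (intro allI impI)
    fix a b :: real assume "0 \<le> a" "0 \<le> b"
    let ?r = "sqrt (a\<^sup>2 + b\<^sup>2)"
    have fin: "finite_measure (rescale c \<nu>)" for c
      unfolding rescale_def using prob
      by (intro prob_space.finite_measure prob_space.prob_space_distr) (auto simp: \<nu>)
    have eq: "(\<integral>\<^sup>+x. f x \<partial>(rescale a \<nu> \<star> rescale b \<nu>)) = (\<integral>\<^sup>+x. f x \<partial>rescale ?r \<nu>)"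
      if f[measurable]: "f \<in> borel_measurable borel" for f
    proof -
      have "(\<integral>\<^sup>+x. f x \<partial>(rescale a \<nu> \<star> rescale b \<nu>)) = (\<integral>\<^sup>+x. \<integral>\<^sup>+y. f (x + y) \<partial>rescale b \<nu> \<partial>rescale a \<nu>)"
        by (intro nn_integral_convolution fin f) (simp_all add: rescale_def)
      also have "\<dots> = (\<integral>\<^sup>+x. \<integral>\<^sup>+y. f (x + b *\<^sub>R (A *v y)) \<partial>?G \<partial>rescale a \<nu>)"
        by (intro nn_integral_cong nn) measurable
      also have "\<dots> = (\<integral>\<^sup>+x. \<integral>\<^sup>+y. f (a *\<^sub>R (A *v x) + b *\<^sub>R (A *v y)) \<partial>?G \<partial>?G)"
        by (rule nn) measurable
      also have "\<dots> = (\<integral>\<^sup>+x. f (?r *\<^sub>R (A *v x)) \<partial>?G)"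
      \<comment> \<open>The rotation lemma asks for a nonzero coefficient of the inner variable,
        here \<open>b / ?r\<close>. For \<open>b = 0\<close> the inner integrand is
        constant.\<close>
      proof (cases "b = 0")
        case True
        then show ?thesis using \<open>0 \<le> a\<close> by (simp add: G.emeasure_space_1)
      next
        case False
        then have r: "?r > 0" by (simp add: sum_power2_gt_zero_iff)
        have "(\<integral>\<^sup>+x. \<integral>\<^sup>+y. f (?r *\<^sub>R (A *v ((b / ?r) *\<^sub>R y + (a / ?r) *\<^sub>R x))) \<partial>?G \<partial>?G) =
            (\<integral>\<^sup>+x. f (?r *\<^sub>R (A *v x)) \<partial>?G)"
        proof (rule nn_integral_std_gaussian_rotate [OF P])
          show "b / ?r \<noteq> 0" using False r by auto
          show "(b / ?r)\<^sup>2 + (a / ?r)\<^sup>2 = 1"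
            using False by (simp add: power_divide add_divide_distrib [symmetric] add.commute)
        qed measurable
        moreover have "?r *\<^sub>R (A *v ((b / ?r) *\<^sub>R y + (a / ?r) *\<^sub>R x)) = a *\<^sub>R (A *v x) + b *\<^sub>R (A *v y)" for x y
          using r by (simp add: matrix_vector_right_distrib matrix_vector_mult_scaleR scaleR_add_right add.commute)
        ultimately show ?thesis by simp
      qed
      finally show ?thesis by (simp add: nn)
    qed
    show "(rescale a \<nu> \<star> rescale b \<nu>) = rescale ?r \<nu>"
    proof (rule measure_eqI)
      fix X assume "X \<in> sets (rescale a \<nu> \<star> rescale b \<nu>)"
      then show "emeasure (rescale a \<nu> \<star> rescale b \<nu>) X = emeasure (rescale ?r \<nu>) X"
        using eq [of "indicator X"] by simp
    qed simp
  qed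
  have third\<nu>: "third_moment \<nu>"
  proof -
    obtain K where K: "\<And>x. norm (A *v x) \<le> norm x * K"
      using bounded_linear.bounded [OF matrix_vector_mul_bounded_linear [of A]] by blast
    have "cubic_growth (\<lambda>x. norm (A *v x) ^ 3)"
    proof (rule cubic_growthI)
      show "\<bar>norm (A *v x) ^ 3\<bar> \<le> \<bar>K\<bar> ^ 3 * (1 + norm x ^ 3)" for x
      proof -
        have "norm (A *v x) \<le> \<bar>K\<bar> * norm x"
          by (rule order_trans [OF K]) (simp add: mult.commute mult_right_mono)
        then have "norm (A *v x) ^ 3 \<le> (\<bar>K\<bar> * norm x) ^ 3" by (intro power_mono) auto
        also have "\<dots> \<le> \<bar>K\<bar> ^ 3 * (1 + norm x ^ 3)" by (simp add: power_mult_distrib distrib_left)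
        finally show ?thesis by simp
      qed
    qed measurable
    from cubic_growth_integrable [OF third this] show ?thesis
      using prob by (simp add: third_moment_def \<nu> integrable_distr_eq)
  qed
  \<comment> \<open>Reflection is the rotation with coefficients \<open>-1\<close> and
    \<open>0\<close>.\<close>
  have sym: "distr ?G borel uminus = ?G"
  proof (rule measure_eqI)
    fix X assume "X \<in> sets (distr ?G borel uminus)"
    then have [measurable]: "X \<in> sets borel" by simp
    have "(\<integral>\<^sup>+y. \<integral>\<^sup>+x. indicator X ((-1) *\<^sub>R x + 0 *\<^sub>R y) \<partial>?G \<partial>?G) = (\<integral>\<^sup>+x. indicator X x \<partial>?G)"
      by (rule nn_integral_std_gaussian_rotate [OF P]) auto
    then have "(\<integral>\<^sup>+x. indicator X (- x) \<partial>?G) = emeasure ?G X"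
      by (simp add: G.emeasure_space_1)
    moreover have "emeasure (distr ?G borel uminus) X = (\<integral>\<^sup>+x. indicator X x \<partial>distr ?G borel uminus)"
      by simp
    moreover have "(\<integral>\<^sup>+x. indicator X x \<partial>distr ?G borel uminus) = (\<integral>\<^sup>+x. indicator X (- x) \<partial>?G)"
      by (rule nn_integral_distr) measurable
    ultimately show "emeasure (distr ?G borel uminus) X = emeasure ?G X" by simp
  qed simp
  have mean: "(\<integral>x. x $ i \<partial>\<nu>) = 0" for i
  proof -
    have eq: "(\<integral>x. x $ i \<partial>\<nu>) = (\<integral>x. (A *v x) $ i \<partial>?G)" by (simp add: \<nu> integral_distr)
    also have "\<dots> = (\<integral>x. (A *v x) $ i \<partial>distr ?G borel uminus)" by (simp only: sym)
    also have "\<dots> = (\<integral>x. (A *v (- x)) $ i \<partial>?G)" by (rule integral_distr) measurable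
    also have "\<dots> = - (\<integral>x. (A *v x) $ i \<partial>?G)" by (simp add: matrix_vector_mult_def sum_negf)
    finally show ?thesis using eq by simp
  qed
  moreover have "(\<integral>x. x $ i * x $ j \<partial>\<nu>) = S $ i $ j" for i j
    using cov mean by (auto simp: covariance_matrix_def)
  ultimately show "centred_law S \<nu>" using third\<nu> by (simp add: centred_law_def)
qed

subsection \<open>The urn model\<close>

lemma deriv_sup_norm_nonneg: "0 \<le> deriv_sup_norm k (h :: real ^ 'n \<Rightarrow> real)"
proof -
  \<comment> \<open>Any index list of length \<open>k\<close> serves as witness that the supremum is
    over a nonempty family.\<close>
  let ?l = "replicate k (undefined :: 'n)"
  have "0 \<le> ereal \<bar>partials ?l h 0\<bar>" by simp
  also have "\<dots> \<le> (SUP x. ereal \<bar>partials ?l h x\<bar>)" by (rule SUP_upper) simp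
  also have "\<dots> \<le> deriv_sup_norm k h" unfolding deriv_sup_norm_def by (rule SUP_upper) simp
  finally show ?thesis .
qed

lemma cubic_taylor_if_partially_differentiable:
  fixes h :: "real ^ 'n \<Rightarrow> real"
  assumes diff: "three_times_partially_differentiable h" and K: "deriv_sup_norm 3 h \<le> ereal K"
  shows "cubic_taylor K h"
proof -
  have d: "((\<lambda>t. partials is h (z + t *\<^sub>R axis i 1)) has_real_derivative partials (i # is) h z) (at 0)"
    if "length is < 3" for "is" i z
  proof -
    have "has_partial_at i (partials is h) z"
      using diff that unfolding three_times_partially_differentiable_def by blast
    then show ?thesis
      by (simp add: has_partial_at_def partial_def DERIV_deriv_iff_field_differentiable)
  qed
  have b: "\<bar>partials [k, j, i] h z\<bar> \<le> K" for i j k z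
  proof -
    have "ereal \<bar>partials [k, j, i] h z\<bar> \<le> (SUP x. ereal \<bar>partials [k, j, i] h x\<bar>)"
      by (rule SUP_upper) simp
    also have "\<dots> \<le> deriv_sup_norm 3 h"
      unfolding deriv_sup_norm_def by (rule SUP_upper) simp
    also note K
    finally show ?thesis by simp
  qed
  have 0: "((\<lambda>t. h (z + t *\<^sub>R axis i 1)) has_real_derivative partials [i] h z) (at 0)" for i z
    using d [of "[]"] by simp
  have 1: "((\<lambda>t. partials [i] h (z + t *\<^sub>R axis j 1)) has_real_derivative partials [j, i] h z) (at 0)" for i j z
    by (rule d) simp
  have 2: "((\<lambda>t. partials [j, i] h (z + t *\<^sub>R axis k 1)) has_real_derivative partials [k, j, i] h z) (at 0)" for i j k z
    by (rule d) simp
  \<comment> \<open>The head of a list is differentiated last, so differentiating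
    \<open>partials [i] h\<close> in direction \<open>j\<close> gives
    \<open>partials [j, i] h\<close>.\<close>
  note taylor = taylor_second_order [where h = h and ?h1.0 = "\<lambda>i. partials [i] h" and ?h2.0 = "\<lambda>i j. partials [j, i] h"
      and ?h3.0 = "\<lambda>i j k. partials [k, j, i] h", OF 0 1 2 b]
  show ?thesis
    unfolding cubic_taylor_def
  proof (intro conjI allI)
    show "h \<in> borel_measurable borel" by (rule borel_measurable_continuous_onI [OF taylor(2)])
    show "\<exists>(a :: 'n \<Rightarrow> real) b. \<forall>y. \<bar>h (x + y) - h x - (\<Sum>i\<in>UNIV. a i * y $ i)
        - (\<Sum>i\<in>UNIV. \<Sum>j\<in>UNIV. b i j * (y $ i * y $ j)) / 2\<bar> \<le> K / 6 * l1_norm y ^ 3" for x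
      by (intro exI allI) (rule taylor(1))
  qed
qed

section \<open>The law of a single ball\<close>

definition urn_step :: "'n::finite \<Rightarrow> real ^ 'n" where
  "urn_step b = (1 / sqrt (1 - 1 / real CARD('n))) *\<^sub>R (\<chi> i. (if b = i then 1 else 0) - 1 / real CARD('n))"

definition urn_law :: "(real ^ 'n) measure" where
  "urn_law = distr (uniform_count_measure UNIV) borel urn_step"

lemma integral_urn_law:
  fixes f :: "real ^ 'n \<Rightarrow> real"
  assumes "f \<in> borel_measurable borel"
  shows "(\<integral>x. f x \<partial>urn_law) = (\<Sum>b\<in>UNIV. f (urn_step b)) / real CARD('n)"
  using assms unfolding urn_law_def
  by (subst integral_distr) (auto simp: integral_uniform_count_measure)

lemma third_moment_urn_law: "third_moment (urn_law :: (real ^ 'n) measure)"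
proof -
  interpret prob_space "uniform_count_measure (UNIV :: 'n set)"
    by (rule prob_space_uniform_count_measure) auto
  have "prob_space (urn_law :: (real ^ 'n) measure)"
    unfolding urn_law_def by (rule prob_space_distr) simp
  then show ?thesis
    by (simp add: third_moment_def urn_law_def integrable_distr_eq uniform_count_measure_def
        integrable_point_measure_finite)
qed

text \<open>The table of second moments itself serves as \<open>S\<close>; it is enough that the
  ball vector and the Gaussian law share it.\<close>

lemma centred_law_urn_law: "\<exists>S. centred_law S (urn_law :: (real ^ 'n) measure)"
proof
  have "(\<integral>x. x $ i \<partial>urn_law) = 0" for i :: 'n
    by (subst integral_urn_law)
      (simp_all add: urn_step_def sum_subtractf sum_divide_distrib [symmetric])
  then show "centred_law (\<chi> i j. \<integral>x. x $ i * x $ j \<partial>urn_law) (urn_law :: (real ^ 'n) measure)"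
    by (simp add: centred_law_def third_moment_urn_law)
qed

text \<open>Before scaling, the chosen urn contributes \<open>1 - 1 / n\<close>, and so do the other
  \<open>n - 1\<close> urns together. After division by \<open>sqrt (1 - 1 / n)\<close> the norm
  stays below \<open>2\<close> for every number of urns.\<close>

lemma l1_norm_urn_step:
  fixes b :: "'n::finite"
  assumes "CARD('n) \<ge> 2"
  shows "l1_norm (urn_step b) = 2 * sqrt (1 - 1 / real CARD('n))"
proof -
  let ?n = "real CARD('n)"
  define q where "q = sqrt (1 - 1 / ?n)"
  have q2: "q * q = 1 - 1 / ?n" using assms by (simp add: q_def)
  have q: "q > 0" using assms by (simp add: q_def)
  have "l1_norm (urn_step b) = (1 / q) * (\<Sum>i\<in>UNIV. \<bar>(if b = i then 1 else 0) - 1 / ?n\<bar>)"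
    using q by (simp add: urn_step_def l1_norm_scaleR q_def [symmetric]) (simp add: l1_norm_def)
  also have "(\<Sum>i\<in>UNIV. \<bar>(if b = i then 1 else 0) - 1 / ?n\<bar>) = (1 - 1 / ?n) + (\<Sum>i\<in>UNIV - {b}. 1 / ?n)"
    using assms by (subst sum.remove [of _ b]) (auto intro!: sum.cong)
  also have "(\<Sum>i\<in>UNIV - {b}. 1 / ?n) = 1 - 1 / ?n"
    using assms by (simp add: card_Diff_singleton of_nat_diff field_simps)
  also have "(1 / q) * (1 - 1 / ?n + (1 - 1 / ?n)) = 2 * q"
    using q by (simp add: q2 [symmetric])
  finally show ?thesis by (simp add: q_def)
qed

lemma l1_cube_urn_law:
  assumes "CARD('n) \<ge> 2"
  shows "l1_cube (urn_law :: (real ^ 'n) measure) = 8 * sqrt (1 - 1 / real CARD('n)) ^ 3"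
  unfolding l1_cube_def
  using assms by (subst integral_urn_law) (auto simp: l1_norm_urn_step power_mult_distrib
      intro: cubic_growth_measurable cubic_growth_l1)

section \<open>Normalized counts as a sum of independent vectors\<close>

lemma (in prob_space) indep_var_sum_last:
  fixes X :: "nat \<Rightarrow> 'a \<Rightarrow> real ^ 'n"
  assumes "indep_vars (\<lambda>_. borel) X {..<Suc k}"
  shows "indep_var borel (\<lambda>\<omega>. \<Sum>j<k. X j \<omega>) borel (X k)"
proof -
  have "indep_var borel ((\<lambda>f. \<Sum>j<k. f j) \<circ> (\<lambda>\<omega>. restrict (\<lambda>j. X j \<omega>) {..<k}))
      borel ((\<lambda>f. f k) \<circ> (\<lambda>\<omega>. restrict (\<lambda>j. X j \<omega>) {k}))"
    by (intro indep_var_compose [OF indep_var_restrict [OF assms]]) auto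
  also have "((\<lambda>f. \<Sum>j<k. f j) \<circ> (\<lambda>\<omega>. restrict (\<lambda>j. X j \<omega>) {..<k})) = (\<lambda>\<omega>. \<Sum>j<k. X j \<omega>)"
    by (auto simp: fun_eq_iff)
  also have "((\<lambda>f. f k) \<circ> (\<lambda>\<omega>. restrict (\<lambda>j. X j \<omega>) {k})) = X k"
    by auto
  finally show ?thesis .
qed

lemma (in prob_space) distr_sum_iid:
  fixes X :: "nat \<Rightarrow> 'a \<Rightarrow> real ^ 'n"
  assumes indep: "indep_vars (\<lambda>_. borel) X {..<m}" and law: "\<And>j. j < m \<Longrightarrow> distr M borel (X j) = \<mu>"
  shows "k \<le> m \<Longrightarrow> distr M borel (\<lambda>\<omega>. \<Sum>j<k. X j \<omega>) = conv_power \<mu> k"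
proof (induction k)
  case 0
  show ?case by (simp add: distr_const)
next
  case (Suc k)
  have rv: "j < m \<Longrightarrow> random_variable borel (X j)" for j
    using indep by (simp add: indep_vars_def)
  have "indep_vars (\<lambda>_. borel) X {..<Suc k}"
    by (rule indep_vars_subset [OF indep]) (use Suc in auto)
  from sum_indep_random_variable [OF indep_var_sum_last [OF this]]
  have "distr M borel (\<lambda>\<omega>. (\<Sum>j<k. X j \<omega>) + X k \<omega>) =
      (distr M borel (\<lambda>\<omega>. \<Sum>j<k. X j \<omega>) \<star> distr M borel (X k))"
    using rv Suc.prems by simp
  then show ?case using Suc law by simp
qed

text \<open>Each count is a sum of indicators, and the mean \<open>m / n\<close> is shared out as
  \<open>1 / n\<close> per ball.\<close>

lemma normalized_counts_eq_sum:
  assumes "CARD('n) \<ge> 2"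
  shows "normalized_counts m B \<omega> = (\<Sum>j<m. (1 / sqrt (real m)) *\<^sub>R urn_step (B j \<omega> :: 'n::finite))"
proof -
  have "real (urn_count m B i \<omega>) = (\<Sum>j<m. if B j \<omega> = i then 1 else 0)" for i :: 'n
    by (simp add: urn_count_def sum.If_cases Int_def lessThan_def)
  then show ?thesis
    by (simp add: vec_eq_iff normalized_counts_def urn_step_def real_sqrt_mult sum_subtractf
        sum_divide_distrib [symmetric] mult.commute)
qed

lemma distr_normalized_counts:
  fixes B :: "nat \<Rightarrow> 'a \<Rightarrow> 'n::finite"
  assumes n: "CARD('n) \<ge> 2" and alloc: "uniform_allocation M m B"
  shows "distr M borel (normalized_counts m B) = conv_power (rescale (1 / sqrt (real m)) urn_law) m"
    and "normalized_counts m B \<in> borel_measurable M"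
proof -
  interpret prob_space M using alloc by (simp add: uniform_allocation_def)
  have indep: "indep_vars (\<lambda>_. count_space UNIV) B {..<m}"
    and law: "\<And>j. j < m \<Longrightarrow> distr M (count_space UNIV) (B j) = uniform_count_measure UNIV"
    using alloc by (auto simp: uniform_allocation_def)
  let ?X = "\<lambda>j \<omega>. (1 / sqrt (real m)) *\<^sub>R urn_step (B j \<omega>)"
  have rv: "random_variable (count_space UNIV) (B j)" if "j < m" for j
    using indep that by (simp add: indep_vars_def)
  have X: "indep_vars (\<lambda>_. borel) ?X {..<m}"
    by (rule indep_vars_compose2 [OF indep]) simp
  have lawX: "distr M borel (?X j) = rescale (1 / sqrt (real m)) urn_law" if "j < m" for j
  proof -
    have "rescale (1 / sqrt (real m)) urn_law =
        distr (uniform_count_measure UNIV) borel (\<lambda>b. (1 / sqrt (real m)) *\<^sub>R urn_step b)"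
      unfolding rescale_def urn_law_def by (subst distr_distr) (auto simp: comp_def)
    also have "\<dots> = distr (distr M (count_space UNIV) (B j)) borel (\<lambda>b. (1 / sqrt (real m)) *\<^sub>R urn_step b)"
      by (simp add: law [OF that])
    also have "\<dots> = distr M borel (?X j)"
      by (subst distr_distr) (auto simp: rv [OF that] comp_def)
    finally show ?thesis ..
  qed
  have eq: "normalized_counts m B = (\<lambda>\<omega>. \<Sum>j<m. ?X j \<omega>)"
    by (rule ext) (rule normalized_counts_eq_sum [OF n])
  show "distr M borel (normalized_counts m B) = conv_power (rescale (1 / sqrt (real m)) urn_law) m"
    unfolding eq by (rule distr_sum_iid [OF X lawX order_refl])
  show "normalized_counts m B \<in> borel_measurable M"
    unfolding eq using X by (intro borel_measurable_sum) (auto simp: indep_vars_def)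
qed

section \<open>Assembling the normal approximation\<close>

lemma covariance_matrix_eq:
  assumes "centred_law S (distr M borel X)" "X \<in> borel_measurable M"
  shows "covariance_matrix M X = S"
proof -
  have "(\<integral>\<omega>. X \<omega> $ i \<partial>M) = 0" for i
    using assms integral_distr [OF assms(2), of "\<lambda>x. x $ i"] by (simp add: centred_law_def)
  moreover have "(\<integral>\<omega>. X \<omega> $ i * X \<omega> $ j \<partial>M) = S $ i $ j" for i j
    using assms integral_distr [OF assms(2), of "\<lambda>x. x $ i * x $ j"] by (simp add: centred_law_def)
  ultimately show ?thesis by (simp add: covariance_matrix_def vec_eq_iff)
qed

text \<open>An exchange at scale \<open>1 / sqrt m\<close> costs a multiple of
  \<open>(1 / sqrt m) ^ 3\<close>, and \<open>m\<close> of them cost the same multiple of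
  \<open>1 / sqrt m\<close>. By stability the \<open>m\<close> rescaled copies of
  \<open>\<nu>\<close> recombine to \<open>\<nu>\<close>.\<close>

theorem iid_sum_normal_approximation:
  fixes \<mu> \<nu> :: "(real ^ 'n) measure"
  assumes h: "cubic_taylor K h" and K: "K \<ge> 0" and m: "m \<ge> 1"
    and \<mu>: "centred_law S \<mu>" and \<nu>: "is_MVN0 S \<nu>" "prob_space \<nu>"
  shows "\<bar>(\<integral>x. h x \<partial>conv_power (rescale (1 / sqrt (real m)) \<mu>) m) - (\<integral>x. h x \<partial>\<nu>)\<bar>
    \<le> lindeberg_constant * K * l1_cube \<mu> / sqrt (real m)"
proof -
  let ?c = "1 / sqrt (real m)"
  note c\<nu> = centred_law_MVN0 [OF \<nu>] and s\<nu> = stable_law_MVN0 [OF \<nu>]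
  have sets: "sets \<nu> = sets borel" using c\<nu> by (simp add: centred_law_def third_moment_def)
  have "close h (lindeberg_constant * K * l1_cube \<mu> * ?c ^ 3) (rescale ?c \<mu>) (rescale ?c \<nu>)"
    by (rule close_stable_law [OF h K \<mu> c\<nu> s\<nu>]) simp
  from close_conv_power [OF cubic_taylor_growth [OF h] centred_law_rescale [OF \<mu>] centred_law_rescale [OF c\<nu>] this, of m]
  have "close h (real m * (lindeberg_constant * K * l1_cube \<mu> * ?c ^ 3))
      (conv_power (rescale ?c \<mu>) m) (conv_power (rescale ?c \<nu>) m)" .
  moreover have "conv_power (rescale ?c \<nu>) m = \<nu>"
  proof -
    have "rescale 1 \<nu> = \<nu>"
      using sets by (simp add: rescale_def distr_id2)
    then show ?thesis using conv_power_stable_law [OF s\<nu> \<nu>(2) sets, of ?c m] m by simp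
  qed
  moreover have "real m * (lindeberg_constant * K * l1_cube \<mu> * ?c ^ 3) = lindeberg_constant * K * l1_cube \<mu> / sqrt (real m)"
    using m by (simp add: power3_eq_cube field_simps)
  ultimately have "close h (lindeberg_constant * K * l1_cube \<mu> / sqrt (real m)) (conv_power (rescale ?c \<mu>) m) \<nu>"
    by simp
  from this [unfolded close_def, rule_format, of 0] show ?thesis by simp
qed

lemma rate_bound:
  assumes K: "K \<ge> 0" and n: "n \<ge> 2" and m: "m \<ge> 1"
  shows "lindeberg_constant * K * (8 * sqrt (1 - 1 / real n) ^ 3) / sqrt (real m)
    \<le> 19 * K * sqrt ((real n ^ 2 + 4 * real m * real n + 6) / (real m * real n * (real n - 1)))"
proof -
  define q where "q = sqrt (1 - 1 / real n)"
  have q: "0 \<le> q" "q \<le> 1" using n by (auto simp: q_def)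
  have "lindeberg_constant * K * (8 * q ^ 3) / sqrt (real m) \<le> 19 * K * (1 / sqrt (real m))"
  proof -
    have "lindeberg_constant * 8 * K * q ^ 3 \<le> lindeberg_constant * 8 * K * 1"
      using q K lindeberg_constant_bound(1) by (intro mult_left_mono power_le_one) auto
    also have "\<dots> \<le> 19 * K"
      using mult_right_mono [OF lindeberg_constant_bound(2) K] by simp
    finally show ?thesis using m by (simp add: divide_right_mono mult_ac)
  qed
  also have "1 / sqrt (real m) \<le> sqrt ((real n ^ 2 + 4 * real m * real n + 6) / (real m * real n * (real n - 1)))"
  proof -
    \<comment> \<open>This is the bound on \<open>1 / m\<close> multiplied by
      \<open>m * n * (n - 1)\<close>.\<close>
    have "real n * (real n - 1) \<le> real n ^ 2 + 4 * real m * real n + 6"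
      using n m by (simp add: power2_eq_square algebra_simps)
    then have "1 / real m \<le> (real n ^ 2 + 4 * real m * real n + 6) / (real m * real n * (real n - 1))"
      using n m by (simp add: divide_le_eq pos_le_divide_eq mult_ac)
    then show ?thesis by (metis real_sqrt_divide real_sqrt_le_iff real_sqrt_one)
  qed
  finally show ?thesis using K by (simp add: q_def mult_left_mono)
qed

theorem theorem4p7:
  fixes n m :: nat
    and M :: "'a measure" and B :: "nat \<Rightarrow> 'a \<Rightarrow> 'n::finite"
    and N :: "'b measure" and Z :: "'b \<Rightarrow> real ^ 'n"
    and h :: "real ^ 'n \<Rightarrow> real"
  defines "X \<equiv> normalized_counts m B"
  assumes "n = CARD('n)" and "n \<ge> 2" and "m \<ge> 1"
    and "uniform_allocation M m B"
    and "prob_space N" and "Z \<in> borel_measurable N"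
    and "is_MVN0 (covariance_matrix M X) (distr N borel Z)"
    and "three_times_partially_differentiable h"
  shows "ereal \<bar>(\<integral>\<omega>. h (X \<omega>) \<partial>M) - (\<integral>\<omega>. h (Z \<omega>) \<partial>N)\<bar>
    \<le> (deriv_sup_norm 2 h + 19 * deriv_sup_norm 3 h) *
       ereal (sqrt ((real n ^ 2 + 4 * real m * real n + 6) / (real m * real n * (real n - 1))))"
proof -
  let ?s = "sqrt ((real n ^ 2 + 4 * real m * real n + 6) / (real m * real n * (real n - 1)))"
  have n: "CARD('n) \<ge> 2" using assms by simp
  note nonneg = deriv_sup_norm_nonneg [of _ h]
  have "(real n ^ 2 + 4 * real m * real n + 6) / (real m * real n * (real n - 1)) > 0"
    using assms by (intro divide_pos_pos mult_pos_pos add_nonneg_pos) auto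
  then have s: "?s > 0" by simp
  show ?thesis
  proof (cases "deriv_sup_norm 3 h")
    \<comment> \<open>The right side is infinite, because \<open>?s > 0\<close> excludes a product
      of infinity and zero.\<close>
    case PInf
    then show ?thesis using nonneg [of 2] s by (cases "deriv_sup_norm 2 h") auto
  next
    case MInf
    then show ?thesis using nonneg [of 3] by simp
  next
    case (real K)
    have K: "K \<ge> 0" using nonneg [of 3] real by simp
    have h: "cubic_taylor K h"
      using cubic_taylor_if_partially_differentiable assms(9) real by (metis order_refl)
    have [measurable]: "h \<in> borel_measurable borel" using h by (simp add: cubic_taylor_def)
    have [measurable]: "X \<in> borel_measurable M"
      unfolding X_def by (rule distr_normalized_counts(2) [OF n assms(5)])
    note law = distr_normalized_counts(1) [OF n assms(5), folded X_def]
    obtain S where S: "centred_law S (urn_law :: (real ^ 'n) measure)"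
      using centred_law_urn_law by blast
    have "real m *\<^sub>R ((1 / sqrt (real m))\<^sup>2 *\<^sub>R S) = S"
      using assms(4) by (simp add: power_divide)
    then have "centred_law S (distr M borel X)"
      using centred_law_conv_power [OF centred_law_rescale [OF S], of m "1 / sqrt (real m)"]
      unfolding law by simp
    \<comment> \<open>The law of \<open>Z\<close> is specified through the covariance matrix of
      \<open>X\<close>; identifying that matrix with \<open>S\<close> shows that it is also the
      covariance matrix of \<open>urn_law\<close>.\<close>
    then have cov: "covariance_matrix M X = S"
      by (rule covariance_matrix_eq) measurable
    interpret N: prob_space N by fact
    note [measurable] = assms(7)
    have "\<bar>(\<integral>\<omega>. h (X \<omega>) \<partial>M) - (\<integral>\<omega>. h (Z \<omega>) \<partial>N)\<bar> =
        \<bar>(\<integral>x. h x \<partial>distr M borel X) - (\<integral>x. h x \<partial>distr N borel Z)\<bar>"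
      by (simp add: integral_distr)
    also have "\<dots> \<le> lindeberg_constant * K * l1_cube (urn_law :: (real ^ 'n) measure) / sqrt (real m)"
      unfolding law using assms(8) cov
      by (intro iid_sum_normal_approximation [OF h K assms(4) S] N.prob_space_distr) auto
    also have "\<dots> \<le> 19 * K * ?s"
      unfolding l1_cube_urn_law [OF n] assms(2) [symmetric] by (rule rate_bound [OF K assms(3,4)])
    finally have "ereal \<bar>(\<integral>\<omega>. h (X \<omega>) \<partial>M) - (\<integral>\<omega>. h (Z \<omega>) \<partial>N)\<bar> \<le> (0 + 19 * deriv_sup_norm 3 h) * ereal ?s"
      by (simp add: real)
    also have "\<dots> \<le> (deriv_sup_norm 2 h + 19 * deriv_sup_norm 3 h) * ereal ?s"
      using s nonneg by (intro ereal_mult_right_mono add_right_mono) auto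
    finally show ?thesis .
  qed
qed

end
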